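(* Let $X$ and $Y$ be irreducible shifts of finite type, $Z$ a sofic shift, and $\phi:X\to Y$, $\psi:Y\to Z$, $\pi:X\to Z$ factor codes with $\pi=\psi\circ\phi$. Then the class degree of $\pi$ equals the class degree of $\psi$ multiplied by the class degree of $\phi$ relative to $\psi$, i.e. $d_\pi=d_\psi\, d_{\phi/\psi}$.
   Context: A shift space over a finite alphabet $\mathcal{A}$ is a closed shift-invariant subset of $\mathcal{A}^{\mathbb{Z}}$ (two-sided). A factor code is a surjective, continuous, shift-commuting map between shift spaces. The coordinates of a point $x$ on a set $I\subset\mathbb{Z}$ are written $x|_I$. A sofic shift is the image of a shift of finite type under a factor code. **Class degree.** Let $\pi:X\to Y$ be a factor code. Given $m\in\mathbb{Z}$ and $x,x'\in X$ with $\pi(x)=\pi(x')$, a $(\pi,m)$-bridge from $x$ to $x'$ is a point $\vec{x}\in X$ such that, for some $n>m$, $\vec{x}|_{(-\infty,m]}=x|_{(-\infty,m]}$, $\vec{x}|_{[n,\infty)}=x'|_{[n,\infty)}$ and $\pi(\vec{x})=\pi(x)=\pi(x')$. Write $x\to_\pi x'$ if for every $m\in\mathbb{Z}$ there is a $(\pi,m)$-bridge from $x$ to $x'$, and $x\sim_\pi x'$ if $x\to_\pi x'$ and $x'\to_\pi x$. This is an equivalence relation; the class of $x$ is denoted $[x]_\pi$ and called a $\pi$-class. For $y\in Y$ let $d_\pi(y)$ be the cardinality of $\{[x]_\pi\mid x\in\pi^{-1}(y)\}$. The class degree of $\pi$ is $d_\pi=\min_{y\in Y}d_\pi(y)$.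 The same definitions apply to $\psi:Y\to Z$, giving $\sim_\psi$ and $d_\psi$. **Relative class degree.** Let $\phi:X\to Y$ and $\psi:Y\to Z$ be factor codes. Given $m\in\mathbb{Z}$ and $x,x'\in X$ with $\phi(x)\sim_\psi\phi(x')$, a $(\phi/\psi,m)$-bridge from $x$ to $x'$ is a point $\vec{x}\in X$ such that, for some $n>m$, $\vec{x}|_{(-\infty,m]}=x|_{(-\infty,m]}$, $\vec{x}|_{[n,\infty)}=x'|_{[n,\infty)}$ and $\phi(x)\sim_\psi\phi(x')\sim_\psi\phi(\vec{x})$. Write $x\to_{\phi/\psi}x'$ if for every $m\in\mathbb{Z}$ there is a $(\phi/\psi,m)$-bridge from $x$ to $x'$, and $x\sim_{\phi/\psi}x'$ if $x\to_{\phi/\psi}x'$ and $x'\to_{\phi/\psi}x$. The equivalence class of $x$ is denoted $[x]_{\phi/\psi}$. For $y\in Y$ let $d_{\phi/\psi}(y)$ be the cardinality of $\{[x]_{\phi/\psi}\mid x\in\phi^{-1}(y)\}$. The class degree of $\phi$ relative to $\psi$ is $d_{\phi/\psi}=\min_{y\in Y}d_{\phi/\psi}(y)$. *)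

theory Defs
  imports "HOL-Analysis.Analysis" "HOL-Library.Extended_Nat"
begin

section \<open>Shift spaces and factor codes\<close>

definition full_shift :: "'a set \<Rightarrow> (int \<Rightarrow> 'a) topology" where
  "full_shift A = product_topology (\<lambda>_. discrete_topology A) UNIV"

definition shift_map :: "(int \<Rightarrow> 'a) \<Rightarrow> (int \<Rightarrow> 'a)" where
  "shift_map x = (\<lambda>i. x (i + 1))"

definition shift_space :: "'a set \<Rightarrow> (int \<Rightarrow> 'a) set \<Rightarrow> bool" where
  "shift_space A X \<longleftrightarrow> finite A \<and> closedin (full_shift A) X \<and> shift_map ` X = X"

definition occurs_in :: "'a list \<Rightarrow> (int \<Rightarrow> 'a) \<Rightarrow> bool" where
  "occurs_in w x \<longleftrightarrow> (\<exists>i. \<forall>k<length w. x (i + int k) = w ! k)"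

definition language :: "(int \<Rightarrow> 'a) set \<Rightarrow> 'a list set" where
  "language X = {w. \<exists>x\<in>X. occurs_in w x}"

definition shift_of_finite_type :: "'a set \<Rightarrow> (int \<Rightarrow> 'a) set \<Rightarrow> bool" where
  "shift_of_finite_type A X \<longleftrightarrow> finite A \<and>
     (\<exists>F. finite F \<and> F \<subseteq> lists A \<and>
          X = {x. (\<forall>i. x i \<in> A) \<and> (\<forall>w\<in>F. \<not> occurs_in w x)})"

definition irreducible_shift :: "(int \<Rightarrow> 'a) set \<Rightarrow> bool" where
  "irreducible_shift X \<longleftrightarrow>
     (\<forall>u\<in>language X. \<forall>v\<in>language X. \<exists>w. u @ w @ v \<in> language X)"

definition factor_code ::
  "'a set \<Rightarrow> (int \<Rightarrow> 'a) set \<Rightarrow> 'b set \<Rightarrow> (int \<Rightarrow> 'b) set \<Rightarrow>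
   ((int \<Rightarrow> 'a) \<Rightarrow> (int \<Rightarrow> 'b)) \<Rightarrow> bool" where
  "factor_code A X B Y f \<longleftrightarrow>
     shift_space A X \<and> shift_space B Y \<and>
     continuous_map (subtopology (full_shift A) X) (subtopology (full_shift B) Y) f \<and>
     f ` X = Y \<and> (\<forall>x\<in>X. f (shift_map x) = shift_map (f x))"

text \<open>The alphabet of the covering shift of finite type is taken in \<^typ>\<open>nat\<close>: types cannot be
  quantified existentially, and every finite alphabet is in bijection with a finite set of
  naturals.\<close>

definition sofic_shift :: "'a set \<Rightarrow> (int \<Rightarrow> 'a) set \<Rightarrow> bool" where
  "sofic_shift A X \<longleftrightarrow>
     (\<exists>(D :: nat set) W f. shift_of_finite_type D W \<and> factor_code D W A X f)"

section \<open>Class degree\<close>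

definition bridge ::
  "(int \<Rightarrow> 'a) set \<Rightarrow> ((int \<Rightarrow> 'a) \<Rightarrow> (int \<Rightarrow> 'b)) \<Rightarrow> int \<Rightarrow>
   (int \<Rightarrow> 'a) \<Rightarrow> (int \<Rightarrow> 'a) \<Rightarrow> (int \<Rightarrow> 'a) \<Rightarrow> bool" where
  "bridge X f m x x' z \<longleftrightarrow> z \<in> X \<and>
     (\<exists>n>m. (\<forall>i\<le>m. z i = x i) \<and> (\<forall>i\<ge>n. z i = x' i)) \<and>
     f z = f x \<and> f x = f x'"

definition leads_to ::
  "(int \<Rightarrow> 'a) set \<Rightarrow> ((int \<Rightarrow> 'a) \<Rightarrow> (int \<Rightarrow> 'b)) \<Rightarrow>
   (int \<Rightarrow> 'a) \<Rightarrow> (int \<Rightarrow> 'a) \<Rightarrow> bool" where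
  "leads_to X f x x' \<longleftrightarrow> x \<in> X \<and> x' \<in> X \<and> f x = f x' \<and>
     (\<forall>m. \<exists>z. bridge X f m x x' z)"

definition class_equiv ::
  "(int \<Rightarrow> 'a) set \<Rightarrow> ((int \<Rightarrow> 'a) \<Rightarrow> (int \<Rightarrow> 'b)) \<Rightarrow>
   (int \<Rightarrow> 'a) \<Rightarrow> (int \<Rightarrow> 'a) \<Rightarrow> bool" where
  "class_equiv X f x x' \<longleftrightarrow> leads_to X f x x' \<and> leads_to X f x' x"

definition class_of ::
  "(int \<Rightarrow> 'a) set \<Rightarrow> ((int \<Rightarrow> 'a) \<Rightarrow> (int \<Rightarrow> 'b)) \<Rightarrow>
   (int \<Rightarrow> 'a) \<Rightarrow> (int \<Rightarrow> 'a) set" where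
  "class_of X f x = {x'. class_equiv X f x x'}"

text \<open>Cardinalities are counted in \<^typ>\<open>enat\<close>, because \<^const>\<open>card\<close> would turn an infinite
  set of classes into \<open>0\<close>.\<close>

definition ecard :: "'a set \<Rightarrow> enat" where
  "ecard S = (if finite S then enat (card S) else \<infinity>)"

definition class_count ::
  "(int \<Rightarrow> 'a) set \<Rightarrow> ((int \<Rightarrow> 'a) \<Rightarrow> (int \<Rightarrow> 'b)) \<Rightarrow> (int \<Rightarrow> 'b) \<Rightarrow> enat" where
  "class_count X f y = ecard {class_of X f x | x. x \<in> X \<and> f x = y}"

text \<open>In \<^typ>\<open>enat\<close> the infimum over a nonempty set is attained, so it is the minimum.\<close>

definition class_degree ::
  "(int \<Rightarrow> 'a) set \<Rightarrow> (int \<Rightarrow> 'b) set \<Rightarrow> ((int \<Rightarrow> 'a) \<Rightarrow> (int \<Rightarrow> 'b)) \<Rightarrow> enat" where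
  "class_degree X Y f = (INF y\<in>Y. class_count X f y)"

section \<open>Relative class degree\<close>

definition rel_bridge ::
  "(int \<Rightarrow> 'a) set \<Rightarrow> (int \<Rightarrow> 'b) set \<Rightarrow>
   ((int \<Rightarrow> 'a) \<Rightarrow> (int \<Rightarrow> 'b)) \<Rightarrow> ((int \<Rightarrow> 'b) \<Rightarrow> (int \<Rightarrow> 'c)) \<Rightarrow> int \<Rightarrow>
   (int \<Rightarrow> 'a) \<Rightarrow> (int \<Rightarrow> 'a) \<Rightarrow> (int \<Rightarrow> 'a) \<Rightarrow> bool" where
  "rel_bridge X Y f g m x x' z \<longleftrightarrow> z \<in> X \<and>
     (\<exists>n>m. (\<forall>i\<le>m. z i = x i) \<and> (\<forall>i\<ge>n. z i = x' i)) \<and>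
     class_equiv Y g (f x) (f x') \<and> class_equiv Y g (f x') (f z)"

definition rel_leads_to ::
  "(int \<Rightarrow> 'a) set \<Rightarrow> (int \<Rightarrow> 'b) set \<Rightarrow>
   ((int \<Rightarrow> 'a) \<Rightarrow> (int \<Rightarrow> 'b)) \<Rightarrow> ((int \<Rightarrow> 'b) \<Rightarrow> (int \<Rightarrow> 'c)) \<Rightarrow>
   (int \<Rightarrow> 'a) \<Rightarrow> (int \<Rightarrow> 'a) \<Rightarrow> bool" where
  "rel_leads_to X Y f g x x' \<longleftrightarrow> x \<in> X \<and> x' \<in> X \<and> class_equiv Y g (f x) (f x') \<and>
     (\<forall>m. \<exists>z. rel_bridge X Y f g m x x' z)"

definition rel_class_equiv ::
  "(int \<Rightarrow> 'a) set \<Rightarrow> (int \<Rightarrow> 'b) set \<Rightarrow>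
   ((int \<Rightarrow> 'a) \<Rightarrow> (int \<Rightarrow> 'b)) \<Rightarrow> ((int \<Rightarrow> 'b) \<Rightarrow> (int \<Rightarrow> 'c)) \<Rightarrow>
   (int \<Rightarrow> 'a) \<Rightarrow> (int \<Rightarrow> 'a) \<Rightarrow> bool" where
  "rel_class_equiv X Y f g x x' \<longleftrightarrow>
     rel_leads_to X Y f g x x' \<and> rel_leads_to X Y f g x' x"

text \<open>The relative class of \<open>x\<close> is taken in all of \<open>X\<close>; it need not lie in a single fibre
  of \<open>f\<close>.\<close>

definition rel_class_of ::
  "(int \<Rightarrow> 'a) set \<Rightarrow> (int \<Rightarrow> 'b) set \<Rightarrow>
   ((int \<Rightarrow> 'a) \<Rightarrow> (int \<Rightarrow> 'b)) \<Rightarrow> ((int \<Rightarrow> 'b) \<Rightarrow> (int \<Rightarrow> 'c)) \<Rightarrow>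
   (int \<Rightarrow> 'a) \<Rightarrow> (int \<Rightarrow> 'a) set" where
  "rel_class_of X Y f g x = {x'. rel_class_equiv X Y f g x x'}"

definition rel_class_count ::
  "(int \<Rightarrow> 'a) set \<Rightarrow> (int \<Rightarrow> 'b) set \<Rightarrow>
   ((int \<Rightarrow> 'a) \<Rightarrow> (int \<Rightarrow> 'b)) \<Rightarrow> ((int \<Rightarrow> 'b) \<Rightarrow> (int \<Rightarrow> 'c)) \<Rightarrow>
   (int \<Rightarrow> 'b) \<Rightarrow> enat" where
  "rel_class_count X Y f g y = ecard {rel_class_of X Y f g x | x. x \<in> X \<and> f x = y}"

definition rel_class_degree ::
  "(int \<Rightarrow> 'a) set \<Rightarrow> (int \<Rightarrow> 'b) set \<Rightarrow>
   ((int \<Rightarrow> 'a) \<Rightarrow> (int \<Rightarrow> 'b)) \<Rightarrow> ((int \<Rightarrow> 'b) \<Rightarrow> (int \<Rightarrow> 'c)) \<Rightarrow> enat" where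
  "rel_class_degree X Y f g = (INF y\<in>Y. rel_class_count X Y f g y)"

end

theory Submission
  imports Defs
begin

text \<open>
  Write \<open>\<sim>\<^sub>\<pi>\<close> and \<open>\<rightarrow>\<^sub>\<pi>\<close> for the class relation and the transition relation of \<open>\<pi>\<close>, and likewise for
  \<open>\<psi>\<close>. The relative relation coincides with \<open>\<sim>\<^sub>\<pi>\<close> (\<open>rel_class_of_eq\<close>): the image of a \<open>\<pi>\<close>-bridge is right
  asymptotic to \<open>\<phi> x'\<close>, hence automatically in its \<open>\<psi>\<close>-class. So the relative class count at \<open>y\<close> is the
  number of \<open>\<pi>\<close>-classes meeting the fibre of \<open>\<phi>\<close> over \<open>y\<close>. Call this set of classes \<open>P y\<close>, and let
  \<open>e\<close> be the least size of \<open>P y\<close>.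

  The map \<open>\<phi>\<close> sends each \<open>\<pi>\<close>-class over \<open>z\<close> into one \<open>\<psi>\<close>-class over \<open>z\<close>, and the classes over a
  \<open>\<psi>\<close>-class \<open>D\<close> include \<open>P y\<close> for every \<open>y\<close> in \<open>D\<close>. This gives at least \<open>e\<close> classes over each \<open>D\<close>
  and the inequality from below (\<open>degree_lower_bound\<close>). For the other inequality a point \<open>z\<close> is needed
  with as few \<open>\<psi>\<close>-classes as possible and with at most \<open>e\<close> classes over each of them.

  Classes are counted by routing. A point is routed through a state at a coordinate if it can be
  altered on a bounded stretch, inside its fibre, so as to pass through that state. A set of pairs of
  a coordinate and a state through which all points in question can be routed is a transversal. If a
  transversal of size \<open>k\<close> recurs, there are at most \<open>k\<close> classes (\<open>card_classes_le\<close>); if a closed set of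
  points of a fibre meets \<open>k\<close> classes, compactness provides a transversal of size \<open>k\<close> valid for all
  points that look similar on a finite window (\<open>transversal_exists\<close>). Since blocks can be made to recur
  in irreducible shifts, no transversal over a point of \<open>Y\<close> has fewer than \<open>e\<close> elements (\<open>cut_ge\<close>).

  Fix a block of \<open>Y\<close> with a transversal of size \<open>e\<close>, and call \<open>y\<close> recurrent if it sees this block
  infinitely often to the right. Suppose \<open>y\<close> and \<open>y'\<close> are recurrent and \<open>y \<rightarrow>\<^sub>\<psi> y'\<close>. Running from \<open>y\<close> to
  \<open>y'\<close> and cutting partly before and partly after the change, the lower bound for cuts yields Hall's
  condition between \<open>P y\<close> and \<open>P y'\<close> with respect to \<open>\<rightarrow>\<^sub>\<pi>\<close>, which is a partial order on classes. If
  Hall's condition holds in both directions between two finite subsets of a partial order, they are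
  equal. Hence \<open>P y = P y'\<close> for equivalent recurrent points (\<open>fibre_classes_eq\<close>).

  It remains to choose \<open>z\<close> such that each \<open>\<pi>\<close>-class over \<open>z\<close> has a member with recurrent image. There is
  a block over which every point of \<open>X\<close> can be altered so that its image shows the given block of \<open>Y\<close>
  (\<open>magic_word\<close>): over a point where the classes of points resisting all such alterations are fewest,
  there are none. A periodic \<open>z\<close> repeating that block and a block responsible for few
  \<open>\<psi>\<close>-classes has all required properties.
\<close>

section \<open>Finite sets and orders\<close>

lemma finite_common_bound:
  fixes Q :: "int \<Rightarrow> 'a \<Rightarrow> bool"
  assumes "finite T" "\<And>t. t \<in> T \<Longrightarrow> \<exists>m. Q m t"
    and mono: "\<And>t m m'. t \<in> T \<Longrightarrow> Q m t \<Longrightarrow> m \<le> m' \<Longrightarrow> Q m' t"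
  obtains m where "\<And>t. t \<in> T \<Longrightarrow> Q m t"
proof -
  obtain f where f: "\<And>t. t \<in> T \<Longrightarrow> Q (f t) t" using assms(2) by metis
  obtain m where m: "\<forall>k\<in>f ` T. k \<le> m"
    using assms(1) by (meson bdd_above.E bdd_above_finite finite_imageI)
  then show ?thesis using that f mono by blast
qed

text \<open>Suppose \<open>c\<close> is maximal among the elements belonging to exactly one of the two sets, say to \<open>P\<close>. All
  elements strictly above \<open>c\<close> in either set are then common to both, so the up-set of \<open>c\<close> in \<open>P\<close> has
  fewer upper neighbours in \<open>P'\<close> than elements, against Hall's condition.\<close>

lemma hall_order_antisym:
  fixes le :: "'a \<Rightarrow> 'a \<Rightarrow> bool"
  assumes fin: "finite P" "finite P'"
    and refl: "\<And>c. c \<in> P \<union> P' \<Longrightarrow> le c c"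
    and trans: "\<And>c d e. le c d \<Longrightarrow> le d e \<Longrightarrow> le c e"
    and antisym: "\<And>c d. c \<in> P \<union> P' \<Longrightarrow> d \<in> P \<union> P' \<Longrightarrow> le c d \<Longrightarrow> le d c \<Longrightarrow> c = d"
    and hall: "\<And>J. J \<subseteq> P \<Longrightarrow> card J \<le> card {c'\<in>P'. \<exists>c\<in>J. le c c'}"
    and hall': "\<And>J. J \<subseteq> P' \<Longrightarrow> card J \<le> card {c'\<in>P. \<exists>c\<in>J. le c c'}"
  shows "P = P'"
proof (rule ccontr)
  assume "P \<noteq> P'"
  define D where "D = (P - P') \<union> (P' - P)"
  have D: "finite D" "D \<noteq> {}" using fin \<open>P \<noteq> P'\<close> by (auto simp: D_def)
  define above where "above c = card {d \<in> P \<union> P'. le c d}" for c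
  have "Min (above ` D) \<in> above ` D" using D by (intro Min_in) auto
  then obtain c where c: "c \<in> D" "above c = Min (above ` D)" by (metis imageE)
  have cmin: "above c \<le> above d" if "d \<in> D" for d
    using that D(1) c(2) by simp
  have max: "d = c" if d: "d \<in> D" "le c d" for d
  proof (rule ccontr)
    assume "d \<noteq> c"
    have cd: "c \<in> P \<union> P'" "d \<in> P \<union> P'" using c(1) d(1) unfolding D_def by blast+
    have "\<not> le d c" using antisym[OF cd d(2)] \<open>d \<noteq> c\<close> by blast
    then have "{e \<in> P \<union> P'. le d e} \<subset> {e \<in> P \<union> P'. le c e}"
      using trans[OF d(2)] refl[OF cd(1)] cd by blast
    then have "above d < above c"
      unfolding above_def using fin by (intro psubset_card_mono) auto
    then show False using cmin[OF d(1)] by simp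
  qed
  have step: False
    if Q: "finite Q" "c \<in> Q" "c \<notin> Q'" "\<And>d. d \<in> Q' \<Longrightarrow> d \<in> Q \<or> d \<in> D" "le c c"
      and hallQ: "card {d\<in>Q. le c d} \<le> card {c'\<in>Q'. \<exists>d\<in>{d\<in>Q. le c d}. le d c'}" for Q Q'
  proof -
    let ?J = "{d\<in>Q. le c d}"
    have "{c'\<in>Q'. \<exists>d\<in>?J. le d c'} \<subseteq> ?J - {c}"
    proof
      fix c' assume "c' \<in> {c'\<in>Q'. \<exists>d\<in>?J. le d c'}"
      then have c': "c' \<in> Q'" "le c c'" using trans by blast+
      then have "c' \<noteq> c" using Q(3) by blast
      then show "c' \<in> ?J - {c}" using Q(4)[OF c'(1)] c' max by blast
    qed
    then have "card {c'\<in>Q'. \<exists>d\<in>?J. le d c'} \<le> card (?J - {c})"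
      using Q(1) by (intro card_mono) auto
    also have "\<dots> < card ?J" using Q(1,2,5) by (intro card_Diff1_less) auto
    finally show False using hallQ by simp
  qed
  have lecc: "le c c" using refl[of c] c(1) unfolding D_def by blast
  show False
  proof (cases "c \<in> P")
    case True
    then have "c \<notin> P'" using c(1) by (simp add: D_def)
    show False
    proof (rule step[OF fin(1) True \<open>c \<notin> P'\<close> _ lecc])
      show "d \<in> P \<or> d \<in> D" if "d \<in> P'" for d using that by (simp add: D_def)
    qed (rule hall, blast)
  next
    case False
    then have "c \<in> P'" using c(1) by (simp add: D_def)
    show False
    proof (rule step[OF fin(2) \<open>c \<in> P'\<close> False _ lecc])
      show "d \<in> P' \<or> d \<in> D" if "d \<in> P" for d using that by (simp add: D_def)
    qed (rule hall', blast)
  qed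
qed

lemma INF_enat_eq:
  assumes "a \<in> S" "\<And>s. s \<in> S \<Longrightarrow> f a \<le> f s"
  shows "(INF s\<in>S. enat (f s)) = enat (f a)"
  using assms by (intro antisym INF_lower INF_greatest) auto

section \<open>Compactness, sliding block codes and shifts of finite type\<close>

definition near :: "int \<Rightarrow> (int \<Rightarrow> 'a) \<Rightarrow> (int \<Rightarrow> 'a) \<Rightarrow> bool" where
  "near K x u \<longleftrightarrow> (\<forall>j. \<bar>j\<bar> \<le> K \<longrightarrow> x j = u j)"

definition translate :: "int \<Rightarrow> (int \<Rightarrow> 'a) \<Rightarrow> int \<Rightarrow> 'a" where
  "translate n x = (\<lambda>j. x (n + j))"

lemma translate_apply: "translate n x j = x (n + j)"
  by (simp add: translate_def)

lemma translate_0 [simp]: "translate 0 x = x"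
  by (simp add: translate_def)

lemma translate_translate [simp]: "translate m (translate n x) = translate (n + m) x"
  by (simp add: translate_def add.assoc)

lemma near_sym: "near K x u \<Longrightarrow> near K u x"
  by (simp add: near_def)

lemma near_mono: "near K x u \<Longrightarrow> K' \<le> K \<Longrightarrow> near K' x u"
  by (simp add: near_def)

lemma openin_near_ball:
  assumes "finite A"
  shows "openin (full_shift A) {u. (\<forall>i. u i \<in> A) \<and> near K x u}"
proof -
  let ?U = "\<lambda>j. if \<bar>j\<bar> \<le> K then A \<inter> {x j} else A"
  have "{j. ?U j \<noteq> A} \<subseteq> {- K .. K}"
    by auto
  then have "finite {j. ?U j \<noteq> A}"
    by (rule finite_subset) simp
  moreover have "{u. (\<forall>i. u i \<in> A) \<and> near K x u} = PiE UNIV ?U"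
  proof (intro set_eqI)
    fix u
    have "(u j \<in> ?U j) \<longleftrightarrow> u j \<in> A \<and> (\<bar>j\<bar> \<le> K \<longrightarrow> x j = u j)" for j
      by (cases "\<bar>j\<bar> \<le> K") auto
    then show "u \<in> {u. (\<forall>i. u i \<in> A) \<and> near K x u} \<longleftrightarrow> u \<in> PiE UNIV ?U"
      unfolding near_def PiE_iff by (simp only: mem_Collect_eq extensional_UNIV) blast
  qed
  moreover have "openin (discrete_topology A) (?U j)" for j
    unfolding openin_discrete_topology by simp
  ultimately show ?thesis
    unfolding full_shift_def by (simp only: openin_PiE_gen topspace_discrete_topology) simp
qed

text \<open>Tychonoff's theorem in sequential form. A cluster point suffices later, because each
  compactness argument there refutes a single bad index.\<close>

lemma cluster_point_full_shift:
  fixes f :: "nat \<Rightarrow> int \<Rightarrow> 'a"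
  assumes "finite A" and "\<And>n i. f n i \<in> A"
  shows "\<exists>x. \<forall>K::int. \<exists>n. K \<le> int n \<and> near K (f n) x"
proof -
  let ?C = "\<lambda>k::nat. (full_shift A) closure_of {f n |n. k \<le> n}"
  have top: "topspace (full_shift A) = {u. \<forall>i. u i \<in> A}"
    by (auto simp: full_shift_def PiE_iff)
  have "compact_space (full_shift A)"
    using assms(1) by (simp add: full_shift_def compact_space_product_topology
        compact_space_discrete_topology)
  moreover have "?C k \<noteq> {}" for k
  proof -
    have "{f n |n. k \<le> n} \<subseteq> ?C k"
      by (rule closure_of_subset) (use assms(2) top in auto)
    then show ?thesis by auto
  qed
  moreover have "decseq ?C"
    by (intro decseq_SucI closure_of_mono) auto
  ultimately have "(\<Inter>k. ?C k) \<noteq> {}"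
    by (intro compact_space_imp_nest) auto
  then obtain x where x: "\<And>k. x \<in> ?C k" by auto
  have xA: "x i \<in> A" for i
    using x[of 0] top by (auto simp: in_closure_of)
  have "\<exists>n. K \<le> int n \<and> near K (f n) x" for K :: int
  proof -
    let ?T = "{u. (\<forall>i. u i \<in> A) \<and> near K x u}"
    have "x \<in> ?T" using xA by (simp add: near_def)
    with openin_near_ball[OF assms(1)] have "\<exists>y. y \<in> {f n |n. nat K \<le> n} \<and> y \<in> ?T"
      using x[of "nat K", unfolded in_closure_of, THEN conjunct2, rule_format, of ?T] by fast
    then obtain n where n: "nat K \<le> n" "near K x (f n)" by blast
    have "K \<le> int n" using n(1) by simp
    then show ?thesis using near_sym[OF n(2)] by blast
  qed
  then show ?thesis by blast
qed

text \<open>Every code occurring below is treated as a block code. One radius \<open>L\<close> serves all codes at once;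
  it also bounds the memory of the shifts of finite type, and points are compared on windows of
  radius \<open>L\<close> instead of being recoded to one-step shifts.\<close>

definition sliding_code ::
  "(int \<Rightarrow> 'a) set \<Rightarrow> int \<Rightarrow> ((int \<Rightarrow> 'a) \<Rightarrow> (int \<Rightarrow> 'b)) \<Rightarrow> bool" where
  "sliding_code X L f \<longleftrightarrow>
     (\<forall>x\<in>X. \<forall>n. f (translate n x) = translate n (f x)) \<and>
     (\<forall>x\<in>X. \<forall>u\<in>X. \<forall>i. (\<forall>j. i - L \<le> j \<and> j \<le> i + L \<longrightarrow> x j = u j) \<longrightarrow> f x i = f u i)"

lemma sliding_code_translate:
  "sliding_code X L f \<Longrightarrow> x \<in> X \<Longrightarrow> f (translate n x) = translate n (f x)"
  unfolding sliding_code_def by blast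

lemma sliding_code_local:
  "sliding_code X L f \<Longrightarrow> x \<in> X \<Longrightarrow> u \<in> X \<Longrightarrow>
    (\<And>j. i - L \<le> j \<Longrightarrow> j \<le> i + L \<Longrightarrow> x j = u j) \<Longrightarrow> f x i = f u i"
  unfolding sliding_code_def by blast

lemma sliding_code_near:
  assumes "sliding_code X L f" "x \<in> X" "u \<in> X" "near (K + L) x u"
  shows "near K (f x) (f u)"
  unfolding near_def
proof (intro allI impI)
  fix j :: int assume j: "\<bar>j\<bar> \<le> K"
  show "f x j = f u j"
  proof (rule sliding_code_local[OF assms(1-3)])
    fix k assume "j - L \<le> k" "k \<le> j + L"
    then have "\<bar>k\<bar> \<le> K + L" using j by linarith
    then show "x k = u k" using assms(4) by (simp add: near_def)
  qed
qed

lemma sliding_code_mono: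
  assumes "sliding_code X L f" "L \<le> L'"
  shows "sliding_code X L' f"
  unfolding sliding_code_def
proof (intro conjI ballI allI impI)
  fix x u i assume *: "x \<in> X" "u \<in> X" "\<forall>j. i - L' \<le> j \<and> j \<le> i + L' \<longrightarrow> x j = u j"
  show "f x i = f u i"
    by (rule sliding_code_local[OF assms(1) *(1,2)]) (use * assms(2) in auto)
qed (use sliding_code_translate[OF assms(1)] in blast)

text \<open>The assumption \<open>locally_in\<close> is the working form of finite type: a sequence all of whose windows
  of radius \<open>L\<close> occur in points of \<open>X\<close> is itself a point of \<open>X\<close>. It yields closedness and the
  right to splice, also at infinitely many places simultaneously.\<close>

locale sft =
  fixes X :: "(int \<Rightarrow> 'a) set" and A :: "'a set" and L :: int
  assumes finite_alphabet: "finite A"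
    and L_nonneg: "0 \<le> L"
    and alphabet: "x \<in> X \<Longrightarrow> x i \<in> A"
    and locally_in: "(\<And>i. \<exists>u\<in>X. \<forall>j. i - L \<le> j \<and> j \<le> i + L \<longrightarrow> x j = u j) \<Longrightarrow> x \<in> X"
    and translate_in [simp, intro]: "x \<in> X \<Longrightarrow> translate n x \<in> X"
    and irreducible: "irreducible_shift X"
begin

lemma cluster_point:
  assumes "\<And>n. f n \<in> X"
  obtains x where "x \<in> X" "\<And>K::int. \<exists>n. K \<le> int n \<and> near K (f n) x"
proof -
  obtain x where x: "\<And>K::int. \<exists>n. K \<le> int n \<and> near K (f n) x"
    using cluster_point_full_shift[of A f] finite_alphabet alphabet assms by blast
  have "x \<in> X"
  proof (rule locally_in)
    fix i
    obtain n where "near (\<bar>i\<bar> + L) (f n) x" using x by blast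
    then have "\<forall>j. i - L \<le> j \<and> j \<le> i + L \<longrightarrow> x j = f n j"
      by (auto simp: near_def)
    then show "\<exists>u\<in>X. \<forall>j. i - L \<le> j \<and> j \<le> i + L \<longrightarrow> x j = u j"
      using assms by blast
  qed
  with x that show ?thesis by blast
qed

text \<open>The window of radius \<open>L\<close> around any centre lies inside the part copied from \<open>x\<close> or inside the
  part copied from \<open>u\<close>, according to the side of \<open>i\<close> on which the centre lies.\<close>

lemma splice_ex:
  assumes x: "x \<in> X" and u: "u \<in> X"
    and agree: "\<And>j. i - L \<le> j \<Longrightarrow> j \<le> i + L \<Longrightarrow> x j = u j"
  obtains w where "w \<in> X" "\<And>j. j \<le> i + L \<Longrightarrow> w j = x j" "\<And>j. i - L \<le> j \<Longrightarrow> w j = u j"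
proof -
  define w where "w = (\<lambda>j. if j < i then x j else u j)"
  have wx: "w j = x j" if "j \<le> i + L" for j
    using that agree[of j] L_nonneg by (auto simp: w_def)
  have wu: "w j = u j" if "i - L \<le> j" for j
    using that agree[of j] L_nonneg by (auto simp: w_def)
  have "w \<in> X"
  proof (rule locally_in)
    fix c
    show "\<exists>v\<in>X. \<forall>j. c - L \<le> j \<and> j \<le> c + L \<longrightarrow> w j = v j"
    proof (cases "c \<le> i")
      case True
      then show ?thesis using x wx by (intro bexI[of _ x]) auto
    next
      case False
      then show ?thesis using u wu by (intro bexI[of _ u]) auto
    qed
  qed
  then show ?thesis using wx wu that by blast
qed

text \<open>Irreducibility joins the central block of \<open>x1\<close> to that of \<open>x2\<close> and back to that of \<open>x1\<close>;
  repeating the resulting loop is allowed because the blocks are longer than the memory. Periodic points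
  serve as recurrent points throughout.\<close>

lemma periodic_point:
  assumes x1: "x1 \<in> X" and x2: "x2 \<in> X" and K: "0 \<le> K"
  obtains x n p where "x \<in> X" "2 * K < p" "p + 2 * K < n" "\<And>k. translate (k * n) x = x"
    "near K x x1" "near K (translate p x) x2"
proof -
  \<comment> \<open>The blocks get an extra margin \<open>L\<close>, so that the two ends of the loop overlap in full windows.\<close>
  define H where "H = K + L"
  have H: "0 \<le> H" "K \<le> H" "L \<le> H" using K L_nonneg by (auto simp: H_def)
  define blk where "blk = (\<lambda>x::int \<Rightarrow> 'a. map x [-H..H])"
  have len: "length (blk x) = nat (2 * H + 1)" for x by (simp add: blk_def)
  have nth: "blk x ! k = x (- H + int k)" if "k < nat (2 * H + 1)" for x k
    using that by (simp add: blk_def)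
  have lang: "blk x \<in> language X" if "x \<in> X" for x
  proof -
    have "\<forall>k<length (blk x). x (- H + int k) = blk x ! k" using nth len by simp
    then show ?thesis unfolding language_def occurs_in_def using that by blast
  qed
  obtain s where "blk x1 @ s @ blk x2 \<in> language X"
    using irreducible lang[OF x1] lang[OF x2] unfolding irreducible_shift_def by blast
  then obtain t where "(blk x1 @ s @ blk x2) @ t @ blk x1 \<in> language X"
    using irreducible lang[OF x1] unfolding irreducible_shift_def by blast
  then obtain y0 i0 where y0: "y0 \<in> X" and
    occ: "\<And>k. k < length (blk x1 @ s @ blk x2 @ t @ blk x1) \<Longrightarrow>
      y0 (i0 + int k) = (blk x1 @ s @ blk x2 @ t @ blk x1) ! k"
    unfolding language_def occurs_in_def by (auto simp del: length_append)
  define y where "y = translate (i0 + H) y0"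
  have y: "y \<in> X" using y0 by (simp add: y_def)
  define p where "p = 2 * H + 1 + int (length s)"
  define n where "n = p + 2 * H + 1 + int (length t)"
  have y1: "y j = x1 j" if "\<bar>j\<bar> \<le> H" for j
  proof -
    define k where "k = nat (H + j)"
    have k: "k < nat (2 * H + 1)" "int k = H + j" using that by (auto simp: k_def)
    have "y0 (i0 + int k) = x1 (- H + int k)"
      using occ[of k] k(1) by (simp add: nth_append len nth)
    then show ?thesis using k(2) by (simp add: y_def translate_apply add.assoc)
  qed
  have y2: "y (p + j) = x2 j" if "\<bar>j\<bar> \<le> H" for j
  proof -
    define k where "k = nat (H + j)"
    have k: "k < nat (2 * H + 1)" "int k = H + j" using that by (auto simp: k_def)
    have "y0 (i0 + int (nat (2 * H + 1) + length s + k)) = x2 (- H + int k)"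
      using occ[of "nat (2 * H + 1) + length s + k"] k(1) by (simp add: nth_append len nth)
    moreover have "int (nat (2 * H + 1) + length s + k) = H + (p + j)"
      using H k(2) by (simp add: p_def)
    ultimately have "y0 (i0 + (H + (p + j))) = x2 (- H + (H + j))" by (simp only: k(2))
    then show ?thesis by (simp add: y_def translate_apply add.assoc)
  qed
  have y3: "y (n + j) = x1 j" if "\<bar>j\<bar> \<le> H" for j
  proof -
    define k where "k = nat (H + j)"
    have k: "k < nat (2 * H + 1)" "int k = H + j" using that by (auto simp: k_def)
    have "y0 (i0 + int (nat (2 * H + 1) + length s + nat (2 * H + 1) + length t + k)) = x1 (- H + int k)"
      using occ[of "nat (2 * H + 1) + length s + nat (2 * H + 1) + length t + k"] k(1)
      by (simp add: nth_append len nth)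
    moreover have "int (nat (2 * H + 1) + length s + nat (2 * H + 1) + length t + k) = H + (n + j)"
      using H k(2) by (simp add: p_def n_def)
    ultimately have "y0 (i0 + (H + (n + j))) = x1 (- H + (H + j))" by (simp only: k(2))
    then show ?thesis by (simp add: y_def translate_apply add.assoc)
  qed
  have n: "0 < n" "2 * H < p" "p + 2 * H < n" using H by (auto simp: n_def p_def)
  define x where "x = (\<lambda>j. y (j mod n))"
  have x_close: "x (i + d) = y (i mod n + d)" if "\<bar>d\<bar> \<le> H" for i d
  proof -
    have "x (i + d) = y ((i mod n + d) mod n)"
      by (simp add: x_def mod_add_left_eq)
    moreover have b: "0 \<le> i mod n" "i mod n < n" using n by auto
    consider "i mod n + d < 0" | "0 \<le> i mod n + d" "i mod n + d < n" | "n \<le> i mod n + d" by linarith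
    then have "y ((i mod n + d) mod n) = y (i mod n + d)"
    proof cases
      case 1
      have "(i mod n + d) mod n = (n + (i mod n + d)) mod n" by simp
      also have "\<dots> = n + (i mod n + d)"
        using 1 b that n H by (intro mod_pos_pos_trivial) linarith+
      finally have "(i mod n + d) mod n = n + (i mod n + d)" .
      then show ?thesis using y1[of "i mod n + d"] y3[of "i mod n + d"] 1 b that by auto
    next
      case 2
      then show ?thesis by simp
    next
      case 3
      have "(i mod n + d) mod n = (i mod n + d - n) mod n" by simp
      also have "\<dots> = i mod n + d - n"
        using 3 b that n H by (intro mod_pos_pos_trivial) linarith+
      finally have "(i mod n + d) mod n = i mod n + d - n" .
      then show ?thesis using y1[of "i mod n + d - n"] y3[of "i mod n + d - n"] 3 b that by auto
    qed
    ultimately show ?thesis by simp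
  qed
  have "x \<in> X"
  proof (rule locally_in)
    fix i
    have "x j = translate (i mod n - i) y j" if "i - L \<le> j" "j \<le> i + L" for j
      using x_close[of "j - i" i] that H by (simp add: translate_apply algebra_simps)
    then show "\<exists>u\<in>X. \<forall>j. i - L \<le> j \<and> j \<le> i + L \<longrightarrow> x j = u j"
      using translate_in[OF y] by blast
  qed
  moreover have "near K x x1"
    using x_close[of _ 0] y1 H by (auto simp: near_def)
  moreover have "near K (translate p x) x2"
    using x_close[of _ p] y2 H n by (auto simp: near_def translate_apply)
  moreover have "translate (k * n) x = x" for k
    by (auto simp: translate_def x_def)
  ultimately show ?thesis using that[of x p n] n H by auto
qed

text \<open>The Curtis--Hedlund--Lyndon theorem. If no radius worked at coordinate \<open>0\<close>, pairs of points
  agreeing on ever larger windows but with different images would cluster at one point, where the code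
  could not be continuous.\<close>

lemma sliding_code_if_continuous:
  assumes cont: "continuous_map (subtopology (full_shift A) X) (subtopology (full_shift B) Y) f"
    and shift: "\<And>x. x \<in> X \<Longrightarrow> f (shift_map x) = shift_map (f x)"
    and into: "f ` X \<subseteq> Y" and YB: "\<And>y i. y \<in> Y \<Longrightarrow> y i \<in> B" and "finite B"
  obtains r where "0 \<le> r" "sliding_code X r f"
proof -
  have sm': "shift_map x = translate 1 x" for x :: "int \<Rightarrow> 'a"
    by (simp add: shift_map_def translate_def add.commute)
  have sm: "shift_map x = translate 1 x" for x :: "int \<Rightarrow> 'b"
    by (simp add: shift_map_def translate_def add.commute)
  have tr: "f (translate n x) = translate n (f x)" if "x \<in> X" for x n
    using that
  proof (induction n arbitrary: x rule: int_induct[where k = 0])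
    case base
    then show ?case by simp
  next
    case (step1 i)
    have "f (translate (i + 1) x) = f (translate 1 (translate i x))" by simp
    also have "\<dots> = translate 1 (f (translate i x))"
      using shift[of "translate i x"] step1.prems unfolding sm' sm by blast
    finally show ?case using step1.IH step1.prems by simp
  next
    case (step2 i)
    have "f (translate i x) = f (translate 1 (translate (i - 1) x))" by simp
    also have "\<dots> = translate 1 (f (translate (i - 1) x))"
      using shift[of "translate (i - 1) x"] step2.prems unfolding sm' sm by blast
    finally have "translate (-1) (translate i (f x)) = translate (-1) (translate 1 (f (translate (i - 1) x)))"
      using step2.IH step2.prems by simp
    then show ?case by simp
  qed
  have "\<exists>r::nat. \<forall>x\<in>X. \<forall>u\<in>X. near (int r) x u \<longrightarrow> f x 0 = f u 0"
  proof (rule ccontr)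
    assume "\<not> ?thesis"
    then have "\<forall>r::nat. \<exists>x u. x \<in> X \<and> u \<in> X \<and> near (int r) x u \<and> f x 0 \<noteq> f u 0" by blast
    then obtain g h where gh: "\<And>r::nat. g r \<in> X \<and> h r \<in> X \<and> near (int r) (g r) (h r) \<and> f (g r) 0 \<noteq> f (h r) 0"
      by metis
    then obtain x where x: "x \<in> X" "\<And>K::int. \<exists>n. K \<le> int n \<and> near K (g n) x"
      using cluster_point[of g] by blast
    let ?V = "{u. (\<forall>i. u i \<in> B) \<and> near 0 (f x) u} \<inter> Y"
    have "openin (subtopology (full_shift B) Y) ?V"
      unfolding openin_subtopology using openin_near_ball[OF \<open>finite B\<close>] by blast
    moreover have top: "topspace (subtopology (full_shift A) X) = X"
      using alphabet by (auto simp: full_shift_def PiE_iff)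
    ultimately have "openin (subtopology (full_shift A) X) {u\<in>X. f u \<in> ?V}"
      using openin_continuous_map_preimage[OF cont, of ?V] by simp
    then obtain T where T: "openin (full_shift A) T" "{u\<in>X. f u \<in> ?V} = T \<inter> X"
      unfolding openin_subtopology by blast
    have "x \<in> {u\<in>X. f u \<in> ?V}" using x(1) into YB by (auto simp: near_def)
    then have "x \<in> T" using T(2) by blast
    then obtain U where U: "finite {i. U i \<noteq> A}" "x \<in> PiE UNIV U" "PiE UNIV U \<subseteq> T"
      using T(1) unfolding full_shift_def openin_product_topology_alt by fastforce
    obtain K where K: "\<And>i. U i \<noteq> A \<Longrightarrow> \<bar>i\<bar> \<le> K"
    proof -
      have "finite (abs ` {i. U i \<noteq> A})" using U(1) by blast
      then obtain K where "\<forall>k\<in>abs ` {i. U i \<noteq> A}. k \<le> K"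
        by (meson bdd_above.E bdd_above_finite)
      then show ?thesis using that by blast
    qed
    have inV: "f u 0 = f x 0" if "u \<in> X" "near K u x" for u
    proof -
      have "u i \<in> U i" for i
      proof (cases "U i = A")
        case True then show ?thesis using that alphabet by auto
      next
        case False
        then have "\<bar>i\<bar> \<le> K" by (rule K)
        then show ?thesis using that(2) U(2) by (auto simp: near_def PiE_iff)
      qed
      then have "u \<in> T" using U(3) by (auto simp: PiE_iff)
      then have "u \<in> {u\<in>X. f u \<in> ?V}" using T(2) that(1) by blast
      then show ?thesis by (simp add: near_def)
    qed
    obtain n where n: "K \<le> int n" "near K (g n) x" using x(2) by blast
    then have "near K (h n) x" using gh[of n] by (auto simp: near_def)
    then show False using inV[of "g n"] inV[of "h n"] gh[of n] n by simp
  qed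
  then obtain r :: nat where r: "\<And>x u. x \<in> X \<Longrightarrow> u \<in> X \<Longrightarrow> near (int r) x u \<Longrightarrow> f x 0 = f u 0"
    by blast
  have "sliding_code X (int r) f"
    unfolding sliding_code_def
  proof (intro conjI ballI allI impI)
    fix x u i assume *: "x \<in> X" "u \<in> X" "\<forall>j. i - int r \<le> j \<and> j \<le> i + int r \<longrightarrow> x j = u j"
    have "f (translate i x) 0 = f (translate i u) 0"
      by (rule r) (use * in \<open>auto simp: near_def translate_apply abs_le_iff\<close>)
    then show "f x i = f u i" using tr * by (simp add: translate_apply)
  qed (use tr in blast)
  then show ?thesis using that[of "int r"] by simp
qed

end

lemma sft_if_shift_of_finite_type:
  assumes fin: "shift_of_finite_type A X" and sp: "shift_space A X" and irr: "irreducible_shift X"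
  obtains L0 where "\<And>L. L0 \<le> L \<Longrightarrow> sft X A L"
proof -
  obtain F where F: "finite F" "X = {x. (\<forall>i. x i \<in> A) \<and> (\<forall>w\<in>F. \<not> occurs_in w x)}"
    using fin unfolding shift_of_finite_type_def by blast
  obtain N where N: "\<And>w. w \<in> F \<Longrightarrow> length w \<le> N"
  proof -
    have "\<forall>w\<in>F. length w \<le> Max (length ` F)" using F(1) by simp
    then show ?thesis using that by blast
  qed
  have sm: "shift_map ` X = X" using sp by (simp add: shift_space_def)
  have tr: "translate n x \<in> X" if "x \<in> X" for n x
    using that
  proof (induction n arbitrary: x rule: int_induct[where k = 0])
    case base
    then show ?case by simp
  next
    case (step1 i)
    have "shift_map (translate i x) \<in> X" using step1 sm by blast
    then show ?case by (simp add: shift_map_def translate_def algebra_simps)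
  next
    case (step2 i)
    then have "translate i x \<in> shift_map ` X" using sm by blast
    then obtain u where u: "u \<in> X" "translate i x = shift_map u" by blast
    have "translate (i - 1) x j = u j" for j
      using fun_cong[OF u(2), of "j - 1"] by (simp add: shift_map_def translate_apply algebra_simps)
    then have "translate (i - 1) x = u" by blast
    then show ?case using u by simp
  qed
  have "sft X A L" if "int N \<le> L" for L
  proof
    show "finite A" using sp by (simp add: shift_space_def)
    show "0 \<le> L" using that by simp
    show "x i \<in> A" if "x \<in> X" for x i using that F(2) by blast
    show "translate n x \<in> X" if "x \<in> X" for x n using that tr by blast
    show "irreducible_shift X" by (rule irr)
    fix x assume *: "\<And>i. \<exists>u\<in>X. \<forall>j. i - L \<le> j \<and> j \<le> i + L \<longrightarrow> x j = u j"
    have "x i \<in> A" for i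
    proof -
      obtain u where "u \<in> X" "\<forall>j. i - L \<le> j \<and> j \<le> i + L \<longrightarrow> x j = u j"
        using *[of i] by blast
      moreover from this that have "x i = u i" by simp
      ultimately show ?thesis using F(2) by simp
    qed
    moreover have "\<not> occurs_in w x" if w: "w \<in> F" for w
    proof
      assume "occurs_in w x"
      then obtain i where i: "\<And>k. k < length w \<Longrightarrow> x (i + int k) = w ! k"
        unfolding occurs_in_def by blast
      obtain u where u: "u \<in> X" "\<forall>j. i + L - L \<le> j \<and> j \<le> i + L + L \<longrightarrow> x j = u j"
        using *[of "i + L"] by blast
      have "u (i + int k) = w ! k" if "k < length w" for k
        using i[OF that] u(2)[rule_format, of "i + int k"] that N[OF w] \<open>int N \<le> L\<close> by auto
      then have "occurs_in w u" unfolding occurs_in_def by blast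
      then show False using u(1) w F(2) by blast
    qed
    ultimately show "x \<in> X" using F(2) by blast
  qed
  then show ?thesis by (rule that)
qed

section \<open>Splicing inside a fibre\<close>

locale sft_code = sft X A L for X :: "(int \<Rightarrow> 'a) set" and A L +
  fixes \<pi> :: "(int \<Rightarrow> 'a) \<Rightarrow> (int \<Rightarrow> 'c)"
  assumes code: "sliding_code X L \<pi>"
begin

text \<open>The vertices of the usual graph presentation: points passing through equal states at a coordinate
  may be spliced there, in \<open>X\<close> and inside a fibre of \<open>\<pi>\<close>.\<close>

definition st :: "(int \<Rightarrow> 'a) \<Rightarrow> int \<Rightarrow> 'a list" where
  "st x i = map (\<lambda>k. x (i + k)) [-L..L]"

lemma st_eq_iff: "st x i = st u i' \<longleftrightarrow> (\<forall>k. - L \<le> k \<and> k \<le> L \<longrightarrow> x (i + k) = u (i' + k))"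
  by (auto simp: st_def)

lemma st_eqD: "st x i = st u i \<Longrightarrow> i - L \<le> j \<Longrightarrow> j \<le> i + L \<Longrightarrow> x j = u j"
  unfolding st_eq_iff by (drule spec[of _ "j - i"]) simp

lemma st_eqI: "(\<And>j. i - L \<le> j \<Longrightarrow> j \<le> i + L \<Longrightarrow> x j = u j) \<Longrightarrow> st x i = st u i"
  unfolding st_eq_iff by simp

lemma st_translate [simp]: "st (translate p x) i = st x (p + i)"
  by (simp add: st_def translate_apply add.assoc)

lemma finite_states: "finite {st x i |x i. x \<in> X}"
proof (rule finite_subset)
  show "finite {w. set w \<subseteq> A \<and> length w = nat (2 * L + 1)}"
    using finite_lists_length_eq[OF finite_alphabet] .
  show "{st x i |x i. x \<in> X} \<subseteq> {w. set w \<subseteq> A \<and> length w = nat (2 * L + 1)}"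
    using alphabet by (auto simp: st_def)
qed

lemma splice_fibre:
  assumes "x \<in> X" "u \<in> X" "st x i = st u i" "\<pi> x = \<pi> u"
  obtains w where "w \<in> X" "\<And>j. j \<le> i + L \<Longrightarrow> w j = x j" "\<And>j. i - L \<le> j \<Longrightarrow> w j = u j" "\<pi> w = \<pi> x"
proof -
  obtain w where w: "w \<in> X" "\<And>j. j \<le> i + L \<Longrightarrow> w j = x j" "\<And>j. i - L \<le> j \<Longrightarrow> w j = u j"
    using splice_ex[OF assms(1,2) st_eqD[OF assms(3)]] by blast
  have "\<pi> w c = \<pi> x c" for c
  proof (cases "c \<le> i")
    case True
    then show ?thesis using w(2) by (intro sliding_code_local[OF code w(1) assms(1)]) simp
  next
    case False
    then have "\<pi> w c = \<pi> u c" using w(3) by (intro sliding_code_local[OF code w(1) assms(2)]) simp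
    then show ?thesis using assms(4) by simp
  qed
  then have "\<pi> w = \<pi> x" by blast
  with w that show ?thesis by blast
qed

text \<open>A bridge with both of its coordinates named. With \<open>x' = x\<close> it is a detour: another path of the
  same fibre that leaves \<open>x\<close> after \<open>a\<close> and is back by \<open>b\<close>.\<close>

definition joins :: "int \<Rightarrow> int \<Rightarrow> (int \<Rightarrow> 'a) \<Rightarrow> (int \<Rightarrow> 'a) \<Rightarrow> (int \<Rightarrow> 'a) \<Rightarrow> bool" where
  "joins a b x x' u \<longleftrightarrow> u \<in> X \<and> (\<forall>j\<le>a. u j = x j) \<and> (\<forall>j\<ge>b. u j = x' j) \<and> \<pi> u = \<pi> x"

lemma joins_mono: "joins a b x x' u \<Longrightarrow> a' \<le> a \<Longrightarrow> b \<le> b' \<Longrightarrow> joins a' b' x x' u"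
  by (simp add: joins_def)

lemma joins_refl: "x \<in> X \<Longrightarrow> joins a b x x x"
  by (simp add: joins_def)

lemma joins_translate:
  assumes "joins a b (translate p x) (translate p x') u" "x \<in> X"
  shows "joins (p + a) (p + b) x x' (translate (- p) u)"
proof -
  have u: "u \<in> X" "\<pi> u = translate p (\<pi> x)"
    using assms sliding_code_translate[OF code] by (auto simp: joins_def)
  have "\<pi> (translate (- p) u) = \<pi> x"
    using u sliding_code_translate[OF code] by simp
  then show ?thesis
    using assms u(1) by (auto simp: joins_def translate_apply)
qed

lemma joins_meet:
  assumes "joins a b x x1 u" "joins c d x2 x' v" "\<pi> x = \<pi> x2" "st u i = st v i" "a \<le> i" "i \<le> d"
  obtains w where "joins a d x x' w" "st w i = st u i"
proof -
  obtain w where w: "w \<in> X" "\<And>j. j \<le> i + L \<Longrightarrow> w j = u j" "\<And>j. i - L \<le> j \<Longrightarrow> w j = v j" "\<pi> w = \<pi> u"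
    using splice_fibre[of u v i] assms by (auto simp: joins_def)
  then have "joins a d x x' w"
    using assms L_nonneg by (auto simp: joins_def)
  moreover have "st w i = st u i" using w(2) by (intro st_eqI) simp
  ultimately show ?thesis using that by blast
qed

lemma joins_trans:
  assumes "joins a b x x' u" "joins c d x' x'' v" "\<pi> x = \<pi> x'" "b + 2 * L \<le> c" "a \<le> b" "c \<le> d"
  obtains w where "joins a d x x'' w"
proof (rule joins_meet[OF assms(1,2,3), of "b + L"])
  show "st u (b + L) = st v (b + L)"
    using assms by (intro st_eqI) (auto simp: joins_def)
qed (use assms L_nonneg that in auto)

text \<open>A detour is determined locally, so it can be copied to a point that looks alike on a
  neighbourhood of the detour, even if it lies over a different point.\<close>

lemma detour_copy:
  assumes j: "joins a b x x u" and x: "x \<in> X" "x' \<in> X" and ab: "a \<le> b"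
    and eq: "\<And>j. a - 2 * L \<le> j \<Longrightarrow> j \<le> b + 2 * L \<Longrightarrow> x' j = x j"
  obtains u' where "joins a b x' x' u'" "\<And>j. a - 2 * L \<le> j \<Longrightarrow> j \<le> b + 2 * L \<Longrightarrow> u' j = u j"
proof -
  have u: "u \<in> X" "\<And>j. j \<le> a \<Longrightarrow> u j = x j" "\<And>j. b \<le> j \<Longrightarrow> u j = x j" "\<pi> u = \<pi> x"
    using j by (auto simp: joins_def)
  obtain v where v: "v \<in> X" "\<And>j. j \<le> a \<Longrightarrow> v j = x' j" "\<And>j. a - 2 * L \<le> j \<Longrightarrow> v j = u j"
  proof (rule splice_ex[OF x(2) u(1), of "a - L"])
    show "x' j = u j" if "a - L - L \<le> j" "j \<le> a - L + L" for j
      using eq[of j] u(2)[of j] that ab L_nonneg by simp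
  qed auto
  obtain w where w: "w \<in> X" "\<And>j. j \<le> b + 2 * L \<Longrightarrow> w j = v j" "\<And>j. b \<le> j \<Longrightarrow> w j = x' j"
  proof (rule splice_ex[OF v(1) x(2), of "b + L"])
    show "v j = x' j" if "b + L - L \<le> j" "j \<le> b + L + L" for j
      using eq[of j] u(3)[of j] v(3)[of j] that ab L_nonneg by simp
  qed auto
  have wu: "w j = u j" if "a - 2 * L \<le> j" "j \<le> b + 2 * L" for j
    using v(3) w(2) that by simp
  have wa: "w j = x' j" if "j \<le> a" for j
    using v(2) w(2) that ab L_nonneg by simp
  have "\<pi> w c = \<pi> x' c" for c
  proof (cases "a - L \<le> c \<and> c \<le> b + L")
    case True
    have "\<pi> w c = \<pi> u c"
      by (rule sliding_code_local[OF code w(1) u(1)]) (use True wu in auto)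
    also have "\<dots> = \<pi> x c" using u(4) by simp
    also have "\<dots> = \<pi> x' c"
      by (rule sliding_code_local[OF code x]) (use True eq in auto)
    finally show ?thesis .
  next
    case False
    show ?thesis
      by (rule sliding_code_local[OF code w(1) x(2)]) (use False wa w(3) in auto)
  qed
  then have "\<pi> w = \<pi> x'" by blast
  then have "joins a b x' x' w" using w wa by (simp add: joins_def)
  then show ?thesis using wu that by blast
qed

section \<open>The transition preorder\<close>

lemma leads_to_iff:
  "leads_to X \<pi> x x' \<longleftrightarrow> x \<in> X \<and> x' \<in> X \<and> \<pi> x = \<pi> x' \<and> (\<forall>m. \<exists>b u. joins m b x x' u)"
proof -
  have "(\<exists>z. bridge X \<pi> m x x' z) \<longleftrightarrow> (\<exists>b u. joins m b x x' u)" if "\<pi> x = \<pi> x'" for m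
  proof
    assume "\<exists>b u. joins m b x x' u"
    then obtain b u where "joins m (max b (m + 1)) x x' u"
      using joins_mono by (metis max.cobounded1 order_refl)
    then show "\<exists>z. bridge X \<pi> m x x' z"
      using that unfolding bridge_def joins_def by (metis less_add_one max_less_iff_conj max.strict_coboundedI2)
  qed (auto simp: bridge_def joins_def)
  then show ?thesis unfolding leads_to_def by blast
qed

lemma leads_toI:
  assumes "x \<in> X" "x' \<in> X" "\<pi> x = \<pi> x'" "\<And>m. \<exists>a b u. m \<le> a \<and> joins a b x x' u"
  shows "leads_to X \<pi> x x'"
  unfolding leads_to_iff using assms joins_mono by blast

lemma leads_toD:
  assumes "leads_to X \<pi> x x'"
  shows "x \<in> X" "x' \<in> X" "\<pi> x = \<pi> x'" "\<And>m. \<exists>b u. m < b \<and> joins m b x x' u"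
proof -
  show "x \<in> X" "x' \<in> X" "\<pi> x = \<pi> x'" using assms by (auto simp: leads_to_iff)
  fix m
  obtain b u where "joins m b x x' u" using assms leads_to_iff by blast
  then have "joins m (max b (m + 1)) x x' u" by (rule joins_mono) auto
  then show "\<exists>b u. m < b \<and> joins m b x x' u" by (metis less_add_one max.strict_coboundedI2)
qed

lemma leads_to_trans:
  assumes "leads_to X \<pi> x x'" "leads_to X \<pi> x' x''"
  shows "leads_to X \<pi> x x''"
proof (rule leads_toI)
  note * = leads_toD[OF assms(1)] and ** = leads_toD[OF assms(2)]
  show "x \<in> X" "x'' \<in> X" "\<pi> x = \<pi> x''" using * ** by auto
  fix m
  obtain b u where 1: "m < b" "joins m b x x' u" using *(4) by blast
  obtain d v where 2: "b + 2 * L < d" "joins (b + 2 * L) d x' x'' v" using **(4) by blast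
  obtain w where "joins m d x x'' w"
    using joins_trans[OF 1(2) 2(2) *(3)] 1 2 by auto
  then show "\<exists>a b u. m \<le> a \<and> joins a b x x'' u" by blast
qed

text \<open>The point \<open>x\<close> is its own bridge. In particular the relation only depends on right tails, and right
  asymptotic points of a fibre are equivalent.\<close>

lemma leads_to_if_right_asymptotic:
  assumes "x \<in> X" "x' \<in> X" "\<pi> x = \<pi> x'" "\<And>j. n \<le> j \<Longrightarrow> x j = x' j"
  shows "leads_to X \<pi> x x'"
proof (rule leads_toI[OF assms(1-3)])
  fix m
  have "joins m n x x' x" using assms by (simp add: joins_def)
  then show "\<exists>a b u. m \<le> a \<and> joins a b x x' u" by blast
qed

lemma leads_to_if_meets:
  assumes "x \<in> X" "x' \<in> X" "\<pi> x = \<pi> x'" "\<And>m. \<exists>i\<ge>m. st x i = st x' i"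
  shows "leads_to X \<pi> x x'"
proof (rule leads_toI[OF assms(1-3)])
  fix m
  obtain i where i: "m \<le> i" "st x i = st x' i" using assms(4) by blast
  obtain w where "joins i i x x' w"
    using joins_meet[OF joins_refl[OF assms(1), of i i] joins_refl[OF assms(2), of i i] assms(3) i(2)] by auto
  then show "\<exists>a b u. m \<le> a \<and> joins a b x x' u" using i(1) by blast
qed

lemma class_equiv_refl: "x \<in> X \<Longrightarrow> class_equiv X \<pi> x x"
  using leads_to_if_right_asymptotic by (simp add: class_equiv_def)

lemma class_equiv_sym: "class_equiv X \<pi> x x' \<Longrightarrow> class_equiv X \<pi> x' x"
  by (simp add: class_equiv_def)

lemma class_equiv_trans: "class_equiv X \<pi> x x' \<Longrightarrow> class_equiv X \<pi> x' x'' \<Longrightarrow> class_equiv X \<pi> x x''"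
  using leads_to_trans by (auto simp: class_equiv_def)

lemma class_of_eq_iff: "x \<in> X \<Longrightarrow> class_of X \<pi> x = class_of X \<pi> x' \<longleftrightarrow> class_equiv X \<pi> x x'"
  unfolding class_of_def
  using class_equiv_refl class_equiv_sym class_equiv_trans by blast

section \<open>Routing through states\<close>

text \<open>The state at \<open>i\<close> may be changed to \<open>s\<close> by a detour. Two points that can both be routed through one
  state can be joined, in both directions; everything about numbers of classes is extracted from this.\<close>

definition routes :: "int \<Rightarrow> int \<Rightarrow> int \<Rightarrow> 'a list \<Rightarrow> (int \<Rightarrow> 'a) \<Rightarrow> bool" where
  "routes a b i s x \<longleftrightarrow> (\<exists>u. joins a b x x u \<and> st u i = s)"

lemma routes_mono: "routes a b i s x \<Longrightarrow> a' \<le> a \<Longrightarrow> b \<le> b' \<Longrightarrow> routes a' b' i s x"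
  unfolding routes_def using joins_mono by blast

lemma routes_refl: "x \<in> X \<Longrightarrow> routes a b i (st x i) x"
  unfolding routes_def using joins_refl by blast

lemma routes_translate: "routes a b i s (translate p x) \<Longrightarrow> x \<in> X \<Longrightarrow> routes (p + a) (p + b) (p + i) s x"
  unfolding routes_def by (metis (no_types, lifting) add_minus_cancel joins_translate st_translate uminus_add_conv_diff add.commute diff_add_cancel add_diff_cancel_left')

lemma joins_if_common_route:
  assumes "routes a b i s x" "routes c d i s x'" "\<pi> x = \<pi> x'" "a \<le> i" "i \<le> d"
  obtains u where "joins a d x x' u"
proof -
  obtain u v where "joins a b x x u" "joins c d x' x' v" "st u i = st v i"
    using assms(1,2) by (auto simp: routes_def)
  then show ?thesis using joins_meet assms(3-5) that by metis
qed

lemma not_equiv_eventually_no_common_route: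
  assumes "x \<in> X" "x' \<in> X" "\<pi> x = \<pi> x'" "\<not> class_equiv X \<pi> x x'"
  shows "\<exists>m. \<forall>a b i s. m \<le> a \<and> a \<le> i \<and> i \<le> b \<longrightarrow> \<not> (routes a b i s x \<and> routes a b i s x')"
proof (rule ccontr)
  assume "\<not> ?thesis"
  then have *: "\<exists>a b i s. m \<le> a \<and> a \<le> i \<and> i \<le> b \<and> routes a b i s x \<and> routes a b i s x'" for m
    by blast
  have "\<exists>a b u. m \<le> a \<and> joins a b x x' u" "\<exists>a b u. m \<le> a \<and> joins a b x' x u" for m
    using *[of m] joins_if_common_route assms(3) by metis+
  then have "leads_to X \<pi> x x'" "leads_to X \<pi> x' x"
    using assms by (auto intro!: leads_toI)
  then show False using assms(4) by (simp add: class_equiv_def)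
qed

text \<open>Sharing routed states arbitrarily far to the right would make two points equivalent. Hence the
  states through which finitely many inequivalent points can be routed are eventually pairwise
  distinct.\<close>

lemma eventually_no_common_route:
  assumes T: "finite T" "T \<subseteq> X" "\<And>x. x \<in> T \<Longrightarrow> \<pi> x = z" "inj_on (class_of X \<pi>) T"
  obtains m where "\<And>x x' a b i s. x \<in> T \<Longrightarrow> x' \<in> T \<Longrightarrow> m \<le> a \<Longrightarrow> a \<le> i \<Longrightarrow> i \<le> b \<Longrightarrow>
    routes a b i s x \<Longrightarrow> routes a b i s x' \<Longrightarrow> x = x'"
proof -
  define Q where "Q m x x' \<longleftrightarrow>
    (\<forall>a b i s. m \<le> a \<and> a \<le> i \<and> i \<le> b \<longrightarrow> \<not> (routes a b i s x \<and> routes a b i s x'))"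
    for m :: int and x x'
  have ex: "\<exists>m. fst xx \<noteq> snd xx \<longrightarrow> Q m (fst xx) (snd xx)" if "xx \<in> T \<times> T" for xx
  proof (cases "fst xx = snd xx")
    case False
    have *: "fst xx \<in> T" "snd xx \<in> T" using that by auto
    then have "\<not> class_equiv X \<pi> (fst xx) (snd xx)"
      using T False class_of_eq_iff by (metis inj_onD subsetD)
    then have "\<exists>m. Q m (fst xx) (snd xx)" unfolding Q_def
      using not_equiv_eventually_no_common_route[of "fst xx" "snd xx"] T * by auto
    then show ?thesis by blast
  qed simp
  obtain m where m: "\<And>xx. xx \<in> T \<times> T \<Longrightarrow> fst xx \<noteq> snd xx \<longrightarrow> Q m (fst xx) (snd xx)"
    by (rule finite_common_bound[of "T \<times> T" "\<lambda>m xx. fst xx \<noteq> snd xx \<longrightarrow> Q m (fst xx) (snd xx)"])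
      (use T(1) ex in \<open>auto simp: Q_def\<close>)
  show ?thesis
  proof (rule that[of m])
    fix x x' a b i s
    assume *: "x \<in> T" "x' \<in> T" "m \<le> a" "a \<le> i" "i \<le> b" "routes a b i s x" "routes a b i s x'"
    then show "x = x'" using m[of "(x, x')"] unfolding Q_def by auto
  qed
qed

lemma class_representatives:
  assumes "\<C> \<subseteq> class_of X \<pi> ` S"
  obtains T where "T \<subseteq> S" "inj_on (class_of X \<pi>) T" "\<C> = class_of X \<pi> ` T"
  using assms subset_image_inj by metis

text \<open>A transversal that occurs again and again bounds the number of classes: otherwise, far to the
  right, two of more than \<open>card G\<close> inequivalent points would be routed through the same element of
  \<open>G\<close>. The elements of \<open>G\<close> may sit at different coordinates; this freedom is essential later, where a
  cut mixes two places.\<close>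

lemma card_classes_le:
  assumes S: "S \<subseteq> X" "\<And>x. x \<in> S \<Longrightarrow> \<pi> x = z" and G: "finite G"
    and ab: "\<And>i s. (i, s) \<in> G \<Longrightarrow> a \<le> i \<and> i \<le> b"
    and rec: "\<And>m. \<exists>p\<ge>m. \<forall>x\<in>S. \<exists>(i, s)\<in>G. routes (p + a) (p + b) (p + i) s x"
  shows "finite (class_of X \<pi> ` S) \<and> card (class_of X \<pi> ` S) \<le> card G"
proof (rule ccontr)
  assume "\<not> ?thesis"
  then have "\<exists>\<C>\<subseteq>class_of X \<pi> ` S. finite \<C> \<and> card \<C> = Suc (card G)"
  proof (cases "finite (class_of X \<pi> ` S)")
    case True
    then show ?thesis using \<open>\<not> _\<close>
      by (metis Suc_leI linorder_not_le obtain_subset_with_card_n)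
  next
    case False
    then show ?thesis using infinite_arbitrarily_large by blast
  qed
  then obtain \<C> where \<C>: "\<C> \<subseteq> class_of X \<pi> ` S" "finite \<C>" "card \<C> = Suc (card G)" by blast
  obtain T where T: "T \<subseteq> S" "inj_on (class_of X \<pi>) T" "\<C> = class_of X \<pi> ` T"
    using class_representatives[OF \<C>(1)] .
  have fT: "finite T" "card T = Suc (card G)"
    using \<C> T finite_image_iff card_image by metis+
  obtain m where m: "\<And>x x' a b i s. x \<in> T \<Longrightarrow> x' \<in> T \<Longrightarrow> m \<le> a \<Longrightarrow> a \<le> i \<Longrightarrow> i \<le> b \<Longrightarrow>
    routes a b i s x \<Longrightarrow> routes a b i s x' \<Longrightarrow> x = x'"
    by (rule eventually_no_common_route[of T z]) (use fT T S in auto)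
  obtain p where p: "m - a \<le> p" "\<And>x. x \<in> S \<Longrightarrow> \<exists>(i, s)\<in>G. routes (p + a) (p + b) (p + i) s x"
    using rec[of "m - a"] by blast
  then have "\<forall>x\<in>T. \<exists>g\<in>G. routes (p + a) (p + b) (p + fst g) (snd g) x"
    using T(1) by (fastforce simp: case_prod_beta)
  then obtain l where l: "\<And>x. x \<in> T \<Longrightarrow> l x \<in> G \<and> routes (p + a) (p + b) (p + fst (l x)) (snd (l x)) x"
    by metis
  have "inj_on l T"
  proof (rule inj_onI)
    fix x x' assume *: "x \<in> T" "x' \<in> T" "l x = l x'"
    have "a \<le> fst (l x) \<and> fst (l x) \<le> b" using l[OF *(1)] ab by (metis prod.collapse)
    then show "x = x'"
      using m[of x x' "p + a" "p + fst (l x)" "p + b" "snd (l x)"] l[OF *(1)] l[OF *(2)] * p(1) by simp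
  qed
  moreover have "l ` T \<subseteq> G" using l by blast
  ultimately have "card T \<le> card G" using G card_inj_on_le by blast
  then show False using fT by simp
qed

text \<open>Every point passes through its own state, so the finitely many states form a transversal.\<close>

lemma finite_classes:
  assumes "S \<subseteq> X" "\<And>x. x \<in> S \<Longrightarrow> \<pi> x = z"
  shows "finite (class_of X \<pi> ` S)"
proof -
  have "finite (class_of X \<pi> ` S) \<and> card (class_of X \<pi> ` S) \<le> card ({0::int} \<times> {st x i |x i. x \<in> X})"
  proof (rule card_classes_le[OF assms, of _ 0 0])
    show "finite ({0} \<times> {st x i |x i. x \<in> X})" using finite_states by blast
    fix m :: int
    show "\<exists>p\<ge>m. \<forall>x\<in>S. \<exists>(i, s)\<in>{0} \<times> {st x i |x i. x \<in> X}. routes (p + 0) (p + 0) (p + i) s x"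
    proof (intro exI[of _ m] conjI ballI)
      fix x assume "x \<in> S"
      then have "(0, st x m) \<in> {0} \<times> {st x i |x i. x \<in> X}" "routes (m + 0) (m + 0) (m + 0) (st x m) x"
        using assms(1) routes_refl[of x m m m] by auto
      then show "\<exists>(i, s)\<in>{0} \<times> {st x i |x i. x \<in> X}. routes (m + 0) (m + 0) (m + i) s x"
        by blast
    qed simp
  qed auto
  then show ?thesis by blast
qed

lemma routes_copy:
  assumes r: "routes a b i s x" and x: "x \<in> X" "x' \<in> X" and ab: "a \<le> i" "i \<le> b"
    and eq: "\<And>j. a - 2 * L \<le> j \<Longrightarrow> j \<le> b + 2 * L \<Longrightarrow> x' j = x j"
  shows "routes a b i s x'"
proof -
  obtain u where u: "joins a b x x u" "st u i = s" using r by (auto simp: routes_def)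
  obtain u' where u': "joins a b x' x' u'" "\<And>j. a - 2 * L \<le> j \<Longrightarrow> j \<le> b + 2 * L \<Longrightarrow> u' j = u j"
    using detour_copy[OF u(1) x _ eq] ab by auto
  have "st u' i = st u i" using u'(2) ab L_nonneg by (intro st_eqI) simp
  then show ?thesis using u u' by (auto simp: routes_def)
qed

section \<open>Transversals and compactness\<close>

text \<open>The set \<open>S\<close> is a condition on whole points and \<open>SK n\<close> is what a window of size \<open>n\<close> sees of it.
  This covers both applications: fibres of a code, and points avoiding a block.\<close>

definition shrinks_to :: "(nat \<Rightarrow> (int \<Rightarrow> 'a) set) \<Rightarrow> (int \<Rightarrow> 'a) set \<Rightarrow> bool" where
  "shrinks_to SK S \<longleftrightarrow> (\<forall>n. S \<subseteq> SK n \<and> SK n \<subseteq> X) \<and> decseq SK \<and>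
     (\<forall>f x. (\<forall>n. f n \<in> SK n) \<and> x \<in> X \<and> (\<forall>K::int. \<exists>n. K \<le> int n \<and> near K (f n) x) \<longrightarrow> x \<in> S)"

lemma shrinks_to_const:
  assumes "shrinks_to SK S"
  shows "shrinks_to (\<lambda>_. S) S"
  using assms unfolding shrinks_to_def decseq_def by blast

lemma shrinks_to_eventually:
  assumes shr: "shrinks_to SK S"
    and loc: "\<And>x. x \<in> S \<Longrightarrow> \<exists>K::int. \<forall>n x'. K \<le> int n \<longrightarrow> x' \<in> SK n \<longrightarrow> near K x' x \<longrightarrow> P n x'"
  shows "\<exists>n. \<forall>x\<in>SK n. P n x"
proof (rule ccontr)
  assume "\<not> ?thesis"
  then obtain f where f: "\<And>n. f n \<in> SK n" "\<And>n. \<not> P n (f n)" by metis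
  then have "f n \<in> X" for n using shr unfolding shrinks_to_def by blast
  then obtain x where x: "x \<in> X" "\<And>K::int. \<exists>n. K \<le> int n \<and> near K (f n) x"
    using cluster_point[of f] by blast
  then have "x \<in> S" using f(1) shr unfolding shrinks_to_def by blast
  then obtain K :: int where "\<forall>n x'. K \<le> int n \<longrightarrow> x' \<in> SK n \<longrightarrow> near K x' x \<longrightarrow> P n x'"
    using loc by blast
  then show False using f x(2)[of K] by blast
qed

lemma routes_near:
  assumes "routes a b i s x" "x \<in> X" "x' \<in> X" "a \<le> i" "i \<le> b" "near (\<bar>a\<bar> + \<bar>b\<bar> + 2 * L) x' x"
  shows "routes a b i s x'"
proof (rule routes_copy[OF assms(1-5)])
  fix j assume "a - 2 * L \<le> j" "j \<le> b + 2 * L"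
  then have "\<bar>j\<bar> \<le> \<bar>a\<bar> + \<bar>b\<bar> + 2 * L" using L_nonneg by linarith
  then show "x' j = x j" using assms(6) by (simp add: near_def)
qed

lemma transversal_extends:
  assumes shr: "shrinks_to SK S"
    and ab: "\<And>i s. (i, s) \<in> G \<Longrightarrow> a \<le> i \<and> i \<le> b"
    and G: "\<And>x. x \<in> S \<Longrightarrow> \<exists>(i, s)\<in>G. routes a b i s x"
  shows "\<exists>n. \<forall>x\<in>SK n. \<exists>(i, s)\<in>G. routes a b i s x"
proof (rule shrinks_to_eventually[OF shr])
  fix x assume x: "x \<in> S"
  then obtain i s where i: "(i, s) \<in> G" "routes a b i s x" using G by blast
  have X: "x \<in> X" using x shr unfolding shrinks_to_def by blast
  have "\<exists>(i, s)\<in>G. routes a b i s x'" if "x' \<in> SK n" "near (\<bar>a\<bar> + \<bar>b\<bar> + 2 * L) x' x" for n x'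
  proof -
    have "x' \<in> X" using that(1) shr unfolding shrinks_to_def by blast
    then have "routes a b i s x'" using routes_near i X ab that(2) by blast
    then show ?thesis using i(1) by blast
  qed
  then show "\<exists>K. \<forall>n x'. K \<le> int n \<longrightarrow> x' \<in> SK n \<longrightarrow> near K x' x \<longrightarrow>
      (\<exists>(i, s)\<in>G. routes a b i s x')"
    by blast
qed

text \<open>Joins from \<open>x\<close> that start late enough are not accidental: they only reach those members of the
  finite set \<open>R\<close> to which \<open>x\<close> leads.\<close>

lemma leads_to_if_joins_late:
  assumes "finite R" "R \<subseteq> X" "x \<in> X" "\<And>r. r \<in> R \<Longrightarrow> \<pi> r = \<pi> x"
  obtains M where "\<And>r a b u. r \<in> R \<Longrightarrow> M \<le> a \<Longrightarrow> joins a b x r u \<Longrightarrow> leads_to X \<pi> x r"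
proof -
  define Q where "Q M r \<longleftrightarrow> (\<forall>a b u. M \<le> a \<longrightarrow> joins a b x r u \<longrightarrow> leads_to X \<pi> x r)" for M r
  have "\<exists>M. Q M r" if "r \<in> R" for r
  proof (rule ccontr)
    assume "\<not> ?thesis"
    then have *: "\<not> leads_to X \<pi> x r" "\<And>M. \<exists>a b u. M \<le> a \<and> joins a b x r u"
      unfolding Q_def by blast+
    have "leads_to X \<pi> x r"
      using *(2) assms that by (intro leads_toI) auto
    with *(1) show False by blast
  qed
  moreover have "Q M' r" if "Q M r" "M \<le> M'" for M M' r
    using that unfolding Q_def by (meson order_trans)
  ultimately obtain M where "\<And>r. r \<in> R \<Longrightarrow> Q M r"
    using finite_common_bound[OF assms(1), of Q] by blast
  then show ?thesis using that unfolding Q_def by blast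
qed

lemma joins_change_left:
  assumes "joins a b x' r u" "x \<in> X" "\<pi> x = \<pi> x'" "\<And>j. a - 2 * L \<le> j \<Longrightarrow> j \<le> a \<Longrightarrow> x' j = x j" "a \<le> b"
  obtains w where "joins a b x r w"
proof -
  have u: "u \<in> X" "\<And>j. j \<le> a \<Longrightarrow> u j = x' j" "\<pi> u = \<pi> x'" using assms(1) by (auto simp: joins_def)
  have "st x (a - L) = st u (a - L)"
    by (rule st_eqI) (use assms(4) u(2) in auto)
  moreover have "\<pi> x = \<pi> u" using assms(3) u(3) by simp
  ultimately obtain w where "w \<in> X" "\<And>j. j \<le> a - L + L \<Longrightarrow> w j = x j"
    "\<And>j. a - L - L \<le> j \<Longrightarrow> w j = u j" "\<pi> w = \<pi> x"
    using splice_fibre[OF assms(2) u(1)] by metis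
  then have "joins a b x r w"
    using assms(1,5) L_nonneg by (auto simp: joins_def)
  then show ?thesis using that by blast
qed

text \<open>By compactness one coordinate \<open>q\<close> suffices for all points of \<open>S\<close> to run into a representative.
  The representative that is reached need not be equivalent to the point, since equivalence is not a
  local property; but the point can be reached again from it. Indeed, let \<open>x'\<close> be close to \<open>x\<close>, let
  \<open>r\<close> represent \<open>x\<close> and let \<open>r'\<close> represent \<open>x'\<close>. Then \<open>x\<close> follows \<open>x'\<close> for a long time and can
  still turn into \<open>r'\<close>, so \<open>x\<close> leads to \<open>r'\<close>, and \<open>r\<close> leads to \<open>x\<close>, to \<open>r'\<close> and to \<open>x'\<close>.\<close>

lemma representatives_are_reached:
  assumes shr: "shrinks_to SK S" and z: "\<And>x. x \<in> S \<Longrightarrow> \<pi> x = z"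
    and R: "finite R" "R \<subseteq> S" "\<And>x. x \<in> S \<Longrightarrow> \<exists>r\<in>R. class_equiv X \<pi> x r"
  shows "\<exists>q::nat. \<forall>x\<in>S. \<exists>r\<in>R. leads_to X \<pi> r x \<and> (\<exists>u. joins 0 (int q - L) x r u)"
proof (rule shrinks_to_eventually[OF shrinks_to_const[OF shr]])
  have SX: "S \<subseteq> X" using shr unfolding shrinks_to_def by blast
  fix x assume x: "x \<in> S"
  then obtain r where r: "r \<in> R" "leads_to X \<pi> x r" "leads_to X \<pi> r x"
    using R(3) unfolding class_equiv_def by blast
  then obtain b u where u: "0 < b" "joins 0 b x r u"
    using leads_toD(4)[of x r 0] by blast
  obtain M where M: "\<And>r a b u. r \<in> R \<Longrightarrow> M \<le> a \<Longrightarrow> joins a b x r u \<Longrightarrow> leads_to X \<pi> x r"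
    by (rule leads_to_if_joins_late[of R x]) (use R SX x z in auto)
  define K where "K = \<bar>b\<bar> + \<bar>M\<bar> + 2 * L"
  have "\<exists>r\<in>R. leads_to X \<pi> r x' \<and> (\<exists>u. joins 0 (int n - L) x' r u)"
    if n: "K \<le> int n" and x': "x' \<in> S" and near: "near K x' x" for n x'
  proof -
    have eq: "x' j = x j" if "\<bar>j\<bar> \<le> K" for j using near that by (simp add: near_def)
    have X: "x \<in> X" "x' \<in> X" "\<pi> x = \<pi> x'" using x x' SX z by auto
    obtain r' where r': "r' \<in> R" "leads_to X \<pi> x' r'" "leads_to X \<pi> r' x'"
      using R(3) x' unfolding class_equiv_def by blast
    then obtain c v where v: "M < c" "joins M c x' r' v" using leads_toD(4)[of x' r' M] by blast
    obtain w where "joins M c x r' w"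
    proof (rule joins_change_left[OF v(2) X(1,3)])
      fix j assume "M - 2 * L \<le> j" "j \<le> M"
      then have "\<bar>j\<bar> \<le> K" using L_nonneg unfolding K_def by linarith
      then show "x' j = x j" by (rule eq)
    qed (use v in auto)
    then have "leads_to X \<pi> x r'" using M r'(1) by blast
    then have rx': "leads_to X \<pi> r x'" using r(3) r'(3) leads_to_trans by blast
    obtain w where "joins 0 b x' r w"
    proof (rule joins_change_left[OF u(2) X(2)])
      fix j assume "0 - 2 * L \<le> j" "j \<le> 0"
      then have "\<bar>j\<bar> \<le> K" using L_nonneg unfolding K_def by linarith
      then show "x j = x' j" using eq by simp
    qed (use u X(3) in auto)
    moreover have "b \<le> int n - L" using n L_nonneg unfolding K_def by linarith
    ultimately have "joins 0 (int n - L) x' r w"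
      using joins_mono by blast
    then show ?thesis using r(1) rx' by blast
  qed
  then show "\<exists>K. \<forall>n x'. K \<le> int n \<longrightarrow> x' \<in> S \<longrightarrow> near K x' x \<longrightarrow>
      (\<exists>r\<in>R. leads_to X \<pi> r x' \<and> (\<exists>u. joins 0 (int n - L) x' r u))"
    by blast
qed

text \<open>Converse to the counting bound: if \<open>S\<close> meets \<open>k\<close> classes, the states of \<open>k\<close> representatives at a
  common coordinate form a transversal for \<open>S\<close>, and by compactness already for a neighbourhood of
  \<open>S\<close>. The latter makes it a property of a finite block, which can be made to recur.\<close>

lemma transversal_exists:
  assumes shr: "shrinks_to SK S" and z: "\<And>x. x \<in> S \<Longrightarrow> \<pi> x = z"
  obtains K :: nat and G where "finite G" "card G \<le> card (class_of X \<pi> ` S)"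
    "\<And>i s. (i, s) \<in> G \<Longrightarrow> 0 \<le> i \<and> i \<le> int K \<and> (\<exists>r\<in>S. st r i = s)"
    "\<And>x. x \<in> SK K \<Longrightarrow> \<exists>(i, s)\<in>G. routes 0 (int K) i s x"
proof -
  have SX: "S \<subseteq> X" using shr unfolding shrinks_to_def by blast
  obtain R where R: "R \<subseteq> S" "inj_on (class_of X \<pi>) R" "class_of X \<pi> ` S = class_of X \<pi> ` R"
    using class_representatives[of "class_of X \<pi> ` S" S] by blast
  have fin: "finite R" "card R = card (class_of X \<pi> ` S)"
    using R finite_classes[OF SX z] finite_image_iff card_image by metis+
  have Req: "\<exists>r\<in>R. class_equiv X \<pi> x r" if "x \<in> S" for x
  proof -
    have "class_of X \<pi> x \<in> class_of X \<pi> ` R" using that R(3) by blast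
    then obtain r where "r \<in> R" "class_of X \<pi> x = class_of X \<pi> r" by blast
    then show ?thesis using class_of_eq_iff that SX by blast
  qed
  obtain q :: nat where q: "\<And>x. x \<in> S \<Longrightarrow> \<exists>r\<in>R. leads_to X \<pi> r x \<and> (\<exists>u. joins 0 (int q - L) x r u)"
    using representatives_are_reached[OF shr z fin(1) R(1) Req] by blast
  have "\<exists>n. \<forall>x\<in>S. \<exists>r\<in>R. routes 0 (int n) (int q) (st r (int q)) x"
  proof (rule shrinks_to_eventually[OF shrinks_to_const[OF shr]])
    fix x assume x: "x \<in> S"
    then obtain r u where r: "r \<in> R" "leads_to X \<pi> r x" and u: "joins 0 (int q - L) x r u" using q by blast
    have rx: "\<pi> x = \<pi> r" "r \<in> X" "x \<in> X" using z x r R(1) SX by auto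
    obtain b v where v: "int q + L < b" "joins (int q + L) b r x v" using leads_toD(4)[OF r(2)] by blast
    have st: "st u (int q) = st r (int q)" "st v (int q) = st r (int q)"
      using u v by (auto simp: joins_def intro!: st_eqI)
    obtain w where "joins 0 b x x w" "st w (int q) = st u (int q)"
      by (rule joins_meet[OF u v(2) rx(1), of "int q"]) (use v(1) L_nonneg st in auto)
    then have w: "routes 0 b (int q) (st r (int q)) x" using st unfolding routes_def by metis
    have "\<exists>r\<in>R. routes 0 (int n) (int q) (st r (int q)) x'"
      if "\<bar>0\<bar> + \<bar>b\<bar> + 2 * L \<le> int n" "x' \<in> S" "near (\<bar>0\<bar> + \<bar>b\<bar> + 2 * L) x' x" for n x'
    proof -
      have "routes 0 b (int q) (st r (int q)) x'"
        by (rule routes_near[OF w rx(3)]) (use that SX v L_nonneg in auto)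
      then have "routes 0 (int n) (int q) (st r (int q)) x'"
        by (rule routes_mono) (use that L_nonneg in auto)
      then show ?thesis using r by blast
    qed
    then show "\<exists>K. \<forall>n x'. K \<le> int n \<longrightarrow> x' \<in> S \<longrightarrow> near K x' x \<longrightarrow>
        (\<exists>r\<in>R. routes 0 (int n) (int q) (st r (int q)) x')" by blast
  qed
  then obtain n where n: "\<And>x. x \<in> S \<Longrightarrow> \<exists>r\<in>R. routes 0 (int n) (int q) (st r (int q)) x" by blast
  define N where "N = int (max n q)"
  define G where "G = (\<lambda>r. (int q, st r (int q))) ` R"
  have G: "\<exists>(i, s)\<in>G. routes 0 N i s x" if "x \<in> S" for x
  proof -
    obtain r where "r \<in> R" "routes 0 (int n) (int q) (st r (int q)) x" using n[OF \<open>x \<in> S\<close>] by blast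
    then have "routes 0 N (int q) (st r (int q)) x" by (auto intro: routes_mono simp: N_def)
    then show ?thesis using \<open>r \<in> R\<close> unfolding G_def by blast
  qed
  have "0 \<le> i \<and> i \<le> N" if "(i, s) \<in> G" for i s
    using that by (auto simp: G_def N_def)
  then obtain k where k: "\<And>x. x \<in> SK k \<Longrightarrow> \<exists>(i, s)\<in>G. routes 0 N i s x"
    using transversal_extends[OF shr _ G] by blast
  define K where "K = max k (max n q)"
  have K: "SK K \<subseteq> SK k" "N \<le> int K"
    using shr unfolding shrinks_to_def decseq_def by (auto simp: K_def N_def)
  show ?thesis
  proof (rule that[of G K])
    show "finite G" "card G \<le> card (class_of X \<pi> ` S)"
      using fin card_image_le[OF fin(1)] by (auto simp: G_def)
    show "0 \<le> i \<and> i \<le> int K \<and> (\<exists>r\<in>S. st r i = s)" if "(i, s) \<in> G" for i s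
      using that R(1) by (auto simp: G_def K_def)
    show "\<exists>(i, s)\<in>G. routes 0 (int K) i s x" if "x \<in> SK K" for x
    proof -
      obtain i s where "(i, s) \<in> G" "routes 0 N i s x" using k \<open>x \<in> SK K\<close> K(1) by blast
      then show ?thesis using routes_mono[of 0 N i s x 0 "int K"] K(2) by auto
    qed
  qed
qed

end

section \<open>A word over which every path can be made to meet a given block\<close>

text \<open>In the application \<open>mark u\<close> says that the image of \<open>u\<close> in the middle shift shows a given block
  around \<open>0\<close>.\<close>

locale marked_code = sft_code X A L \<pi>
  for X :: "(int \<Rightarrow> 'a) set" and A L and \<pi> :: "(int \<Rightarrow> 'a) \<Rightarrow> (int \<Rightarrow> 'c)" +
  fixes mark :: "(int \<Rightarrow> 'a) \<Rightarrow> bool" and H :: int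
  assumes H_nonneg: "0 \<le> H"
    and mark_near: "u \<in> X \<Longrightarrow> u' \<in> X \<Longrightarrow> near H u u' \<Longrightarrow> mark u \<Longrightarrow> mark u'"
    and mark_ex: "\<exists>x\<in>X. mark x"
begin

definition inserts :: "int \<Rightarrow> (int \<Rightarrow> 'a) \<Rightarrow> bool" where
  "inserts n x \<longleftrightarrow> (\<exists>u p. joins 0 n x x u \<and> H \<le> p \<and> p + H \<le> n \<and> mark (translate p u))"

lemma inserts_mono:
  assumes "inserts n x" "n \<le> n'"
  shows "inserts n' x"
proof -
  obtain u p where u: "joins 0 n x x u" "H \<le> p" "p + H \<le> n" "mark (translate p u)"
    using assms(1) unfolding inserts_def by blast
  have "joins 0 n' x x u" "p + H \<le> n'"
    using joins_mono[OF u(1) order_refl assms(2)] u(3) assms(2) by auto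
  then show ?thesis unfolding inserts_def using u by blast
qed

lemma inserts_translate:
  assumes "inserts n (translate p x)" "x \<in> X" "0 \<le> p"
  shows "inserts (p + n) x"
proof -
  obtain u q where u: "joins 0 n (translate p x) (translate p x) u" "H \<le> q" "q + H \<le> n" "mark (translate q u)"
    using assms(1) unfolding inserts_def by blast
  have "joins (p + 0) (p + n) x x (translate (- p) u)"
    using joins_translate[OF u(1) assms(2)] .
  then have "joins 0 (p + n) x x (translate (- p) u)"
    by (rule joins_mono) (use assms(3) in auto)
  moreover have "mark (translate (p + q) (translate (- p) u))" using u(4) by simp
  moreover have "H \<le> p + q" "p + q + H \<le> p + n" using u assms(3) by auto
  ultimately show ?thesis unfolding inserts_def by blast
qed

definition avoiders :: "(int \<Rightarrow> 'c) \<Rightarrow> (int \<Rightarrow> 'a) set" where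
  "avoiders z = {x\<in>X. \<pi> x = z \<and> (\<forall>n. \<not> inserts n x)}"

definition near_avoiders :: "(int \<Rightarrow> 'c) \<Rightarrow> nat \<Rightarrow> (int \<Rightarrow> 'a) set" where
  "near_avoiders z n = {x\<in>X. near (int n) (\<pi> x) z \<and> \<not> inserts (int n) x}"

lemma shrinks_to_avoiders: "shrinks_to (near_avoiders z) (avoiders z)"
  unfolding shrinks_to_def
proof (intro conjI allI impI)
  show "avoiders z \<subseteq> near_avoiders z n" "near_avoiders z n \<subseteq> X" for n
    by (auto simp: avoiders_def near_avoiders_def near_def)
  show "decseq (near_avoiders z)"
  proof (rule decseq_SucI)
    fix n
    show "near_avoiders z (Suc n) \<subseteq> near_avoiders z n"
    proof
      fix x assume "x \<in> near_avoiders z (Suc n)"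
      then have x: "x \<in> X" "near (int (Suc n)) (\<pi> x) z" "\<not> inserts (int (Suc n)) x"
        by (auto simp: near_avoiders_def)
      have "near (int n) (\<pi> x) z" by (rule near_mono[OF x(2)]) simp
      moreover have "\<not> inserts (int n) x" using inserts_mono[of "int n" x "int (Suc n)"] x(3) by auto
      ultimately show "x \<in> near_avoiders z n" using x(1) by (simp add: near_avoiders_def)
    qed
  qed
  fix f x
  assume asm: "(\<forall>n. f n \<in> near_avoiders z n) \<and> x \<in> X \<and> (\<forall>K. \<exists>n. K \<le> int n \<and> near K (f n) x)"
  then have f: "\<And>n. f n \<in> X" "\<And>n. near (int n) (\<pi> (f n)) z" "\<And>n. \<not> inserts (int n) (f n)"
    and x: "x \<in> X" and cl: "\<And>K. \<exists>n. K \<le> int n \<and> near K (f n) x"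
    unfolding near_avoiders_def by blast+
  have "\<pi> x j = z j" for j
  proof -
    obtain n where n: "\<bar>j\<bar> + L \<le> int n" "near (\<bar>j\<bar> + L) (f n) x" using cl by blast
    have "\<pi> (f n) j = \<pi> x j"
      using sliding_code_near[OF code f(1) x n(2)] by (simp add: near_def)
    moreover have "\<bar>j\<bar> \<le> int n" using n(1) L_nonneg by linarith
    then have "\<pi> (f n) j = z j" using f(2)[of n] by (simp add: near_def)
    ultimately show ?thesis by simp
  qed
  moreover have "\<not> inserts b x" for b
  proof
    assume "inserts b x"
    then obtain u p where u: "joins 0 b x x u" "H \<le> p" "p + H \<le> b" "mark (translate p u)"
      unfolding inserts_def by blast
    have b: "0 \<le> b" using u H_nonneg by linarith
    obtain n where n: "b + 2 * L \<le> int n" "near (b + 2 * L) (f n) x" using cl by blast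
    obtain u' where u': "joins 0 b (f n) (f n) u'" "\<And>j. 0 - 2 * L \<le> j \<Longrightarrow> j \<le> b + 2 * L \<Longrightarrow> u' j = u j"
    proof (rule detour_copy[OF u(1) x f(1) b])
      fix j assume "0 - 2 * L \<le> j" "j \<le> b + 2 * L"
      then have "\<bar>j\<bar> \<le> b + 2 * L" using b by linarith
      then show "f n j = x j" using n(2) by (simp add: near_def)
    qed auto
    have "near H (translate p u) (translate p u')"
      unfolding near_def translate_apply
    proof (intro allI impI)
      fix j :: int assume "\<bar>j\<bar> \<le> H"
      then show "u (p + j) = u' (p + j)" using u'(2)[of "p + j"] u L_nonneg by auto
    qed
    then have "mark (translate p u')"
      using mark_near[OF _ _ _ u(4)] u(1) u'(1) by (auto simp: joins_def)
    then have "inserts b (f n)" unfolding inserts_def using u u' by blast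
    then have "inserts (int n) (f n)" by (rule inserts_mono) (use n L_nonneg in linarith)
    then show False using f(3) by blast
  qed
  ultimately show "x \<in> avoiders z" using x unfolding avoiders_def by blast
qed

text \<open>Let \<open>z0\<close> have the least number of classes of avoiders, and suppose that there are some. They have
  a transversal \<open>G\<close> of that size, and some avoider \<open>r\<close> passes through an element \<open>(i, s)\<close> of \<open>G\<close>. Let
  the periodic point \<open>y\<close> repeat the block of \<open>r\<close> and meet a mark in between. Over the image of \<open>y\<close>
  there are again at least \<open>card G\<close> classes of avoiders, so at each repetition far to the right their
  representatives are matched with all of \<open>G\<close>, and one of them is routed through \<open>s\<close>. Some
  representative is so at two repetitions; between them it can follow \<open>y\<close> and thus insert a mark.\<close>

lemma avoiders_collapse:
  assumes min: "\<And>x. x \<in> X \<Longrightarrow> card (class_of X \<pi> ` avoiders z0) \<le> card (class_of X \<pi> ` avoiders (\<pi> x))"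
  shows "avoiders z0 = {}"
proof (rule ccontr)
  assume ne: "avoiders z0 \<noteq> {}"
  have av: "x \<in> X" "\<pi> x = z" if "x \<in> avoiders z" for x z using that by (auto simp: avoiders_def)
  obtain K :: nat and G where G: "finite G" "card G \<le> card (class_of X \<pi> ` avoiders z0)"
    "\<And>i s. (i, s) \<in> G \<Longrightarrow> 0 \<le> i \<and> i \<le> int K \<and> (\<exists>r\<in>avoiders z0. st r i = s)"
    "\<And>x. x \<in> near_avoiders z0 K \<Longrightarrow> \<exists>(i, s)\<in>G. routes 0 (int K) i s x"
    by (rule transversal_exists[OF shrinks_to_avoiders av(2)]) auto
  have "avoiders z0 \<subseteq> near_avoiders z0 K"
    using shrinks_to_avoiders unfolding shrinks_to_def by blast
  then obtain i s where ii: "(i, s) \<in> G" using ne G(4) by blast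
  then obtain r where i: "0 \<le> i" "i \<le> int K" and r: "r \<in> avoiders z0" "st r i = s" using G(3) by blast
  obtain xv where xv: "xv \<in> X" "mark xv" using mark_ex by blast
  define K' where "K' = int K + H + L"
  have K': "0 \<le> K'" "int K \<le> K'" "H \<le> K'" "int K + L \<le> K'" using H_nonneg L_nonneg by (auto simp: K'_def)
  obtain y n p where y: "y \<in> X" and np: "2 * K' < p" "p + 2 * K' < n" and per: "\<And>k. translate (k * n) y = y"
    and yr: "near K' y r" and yv: "near K' (translate p y) xv"
    by (rule periodic_point[OF av(1)[OF r(1)] xv(1) K'(1)]) (rule that)
  have n: "0 < n" "int K < n" using np K' by auto
  define z where "z = \<pi> y"
  have zper: "translate (k * n) z = z" for k
    using sliding_code_translate[OF code y, of "k * n"] per by (simp add: z_def)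
  have z0: "near (int K) z z0"
  proof -
    have "near (int K) (\<pi> y) (\<pi> r)"
      by (rule sliding_code_near[OF code y av(1)[OF r(1)]]) (rule near_mono[OF yr K'(4)])
    then show ?thesis using av(2)[OF r(1)] by (simp add: z_def)
  qed
  have lab: "\<exists>g\<in>G. routes (k * n) (k * n + int K) (k * n + fst g) (snd g) x"
    if x: "x \<in> avoiders z" and k: "0 \<le> k" for x k
  proof -
    have X: "x \<in> X" "\<pi> x = z" using av x by auto
    have "\<not> inserts (int K) (translate (k * n) x)"
      using inserts_translate[OF _ X(1), of "int K" "k * n"] x k n(1) unfolding avoiders_def by auto
    moreover have "\<pi> (translate (k * n) x) = z"
      using sliding_code_translate[OF code X(1)] X(2) zper by simp
    ultimately have "translate (k * n) x \<in> near_avoiders z0 K"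
      using X z0 by (simp add: near_avoiders_def)
    then obtain i s where "(i, s) \<in> G" "routes 0 (int K) i s (translate (k * n) x)" using G(4) by blast
    then have "routes (k * n + 0) (k * n + int K) (k * n + i) s x"
      using routes_translate X(1) by blast
    then show ?thesis using \<open>(i, s) \<in> G\<close> by force
  qed
  obtain T where T: "T \<subseteq> avoiders z" "inj_on (class_of X \<pi>) T"
    "class_of X \<pi> ` avoiders z = class_of X \<pi> ` T"
    using class_representatives[of "class_of X \<pi> ` avoiders z" "avoiders z"] by blast
  have fin: "finite T" "card T = card (class_of X \<pi> ` avoiders z)"
    using T finite_classes[of "avoiders z" z] av finite_image_iff card_image by (metis subsetI)+
  have cardT: "card G \<le> card T" using fin(2) G(2) min[OF y] by (simp add: z_def)
  obtain m where m: "\<And>x x' a b i s. x \<in> T \<Longrightarrow> x' \<in> T \<Longrightarrow> m \<le> a \<Longrightarrow> a \<le> i \<Longrightarrow> i \<le> b \<Longrightarrow>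
    routes a b i s x \<Longrightarrow> routes a b i s x' \<Longrightarrow> x = x'"
    by (rule eventually_no_common_route[of T z]) (use fin T av in auto)
  have hit: "\<exists>x\<in>T. routes (k * n) (k * n + int K) (k * n + i) s x" if k: "\<bar>m\<bar> \<le> k" for k
  proof -
    have mk: "m \<le> k * n" "0 \<le> k"
      using k n(1) by (smt (verit) mult_le_cancel_left1)+
    have "\<forall>x\<in>T. \<exists>g\<in>G. routes (k * n) (k * n + int K) (k * n + fst g) (snd g) x"
      using lab T(1) mk(2) by blast
    then obtain l where l: "\<And>x. x \<in> T \<Longrightarrow> l x \<in> G"
      "\<And>x. x \<in> T \<Longrightarrow> routes (k * n) (k * n + int K) (k * n + fst (l x)) (snd (l x)) x" by metis
    have "inj_on l T"
    proof (rule inj_onI)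
      fix x x' assume *: "x \<in> T" "x' \<in> T" "l x = l x'"
      have "0 \<le> fst (l x)" "fst (l x) \<le> int K" using l(1)[OF *(1)] G(3)[of "fst (l x)" "snd (l x)"] by auto
      then show "x = x'"
        using m[OF *(1,2) mk(1) _ _ l(2)[OF *(1)]] l(2)[OF *(2)] *(3) by simp
    qed
    then have "l ` T = G"
      using l(1) cardT G(1) card_image[of l T] by (intro card_seteq) auto
    then obtain x where "x \<in> T" "l x = (i, s)" using ii by (metis imageE)
    then show ?thesis using l(2)[of x] by auto
  qed
  then obtain c where c: "\<And>k. \<bar>m\<bar> \<le> k \<Longrightarrow> c k \<in> T"
    "\<And>k. \<bar>m\<bar> \<le> k \<Longrightarrow> routes (k * n) (k * n + int K) (k * n + i) s (c k)" by metis
  \<comment> \<open>Spacing the repetitions by three periods leaves room for a full period containing the mark.\<close>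
  have "\<not> inj (\<lambda>t::nat. c (\<bar>m\<bar> + 3 * int t))"
  proof
    assume "inj (\<lambda>t::nat. c (\<bar>m\<bar> + 3 * int t))"
    moreover have "range (\<lambda>t::nat. c (\<bar>m\<bar> + 3 * int t)) \<subseteq> T" using c(1) by auto
    ultimately show False using fin(1) by (metis finite_subset infinite_UNIV_nat finite_imageD)
  qed
  then obtain t t' :: nat where t: "t < t'" "c (\<bar>m\<bar> + 3 * int t) = c (\<bar>m\<bar> + 3 * int t')"
    unfolding inj_def by (metis linorder_neqE_nat)
  define x where "x = c (\<bar>m\<bar> + 3 * int t)"
  define k1 where "k1 = \<bar>m\<bar> + 3 * int t"
  define k2 where "k2 = \<bar>m\<bar> + 3 * int t'"
  have k: "0 \<le> k1" "k1 + 3 \<le> k2" using t by (auto simp: k1_def k2_def)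
  have kn: "0 \<le> k1 * n" "k1 * n + 3 * n \<le> k2 * n"
    using k n mult_right_mono[OF k(2), of n] by (auto simp: algebra_simps)
  have xT: "x \<in> T" using c(1) by (simp add: x_def)
  have xa: "x \<in> avoiders z" "x \<in> X" "\<pi> x = z" using xT T(1) av by auto
  obtain u1 u2 where u1: "joins (k1 * n) (k1 * n + int K) x x u1" "st u1 (k1 * n + i) = s"
    and u2: "joins (k2 * n) (k2 * n + int K) x x u2" "st u2 (k2 * n + i) = s"
    using c(2)[of k1] c(2)[of k2] t(2) unfolding routes_def by (auto simp: x_def k1_def k2_def)
  have sty: "st y (k * n + i) = s" for k
  proof -
    have "st y (k * n + i) = st y i" using st_translate[of "k * n" y i] per by simp
    also have "\<dots> = st r i"
    proof (rule st_eqI)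
      fix j assume "i - L \<le> j" "j \<le> i + L"
      then have "\<bar>j\<bar> \<le> K'" using i K' by linarith
      then show "y j = r j" using yr by (simp add: near_def)
    qed
    finally show ?thesis using r(2) by simp
  qed
  obtain w1 where w1: "w1 \<in> X" "\<And>j. j \<le> k1 * n + i + L \<Longrightarrow> w1 j = u1 j"
    "\<And>j. k1 * n + i - L \<le> j \<Longrightarrow> w1 j = y j" "\<pi> w1 = z"
    using splice_fibre[of u1 y "k1 * n + i"] u1 y sty xa unfolding joins_def z_def by metis
  have "st w1 (k2 * n + i) = st y (k2 * n + i)"
    by (rule st_eqI) (use w1(3) kn n in auto)
  then obtain w where w: "w \<in> X" "\<And>j. j \<le> k2 * n + i + L \<Longrightarrow> w j = w1 j"
    "\<And>j. k2 * n + i - L \<le> j \<Longrightarrow> w j = u2 j" "\<pi> w = z"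
    using splice_fibre[of w1 u2 "k2 * n + i"] u2 w1 sty xa unfolding joins_def by metis
  have "joins 0 (k2 * n + int K) x x w"
    unfolding joins_def
  proof (intro conjI allI impI)
    show "w j = x j" if "j \<le> 0" for j
    proof -
      have "w j = w1 j" "w1 j = u1 j" using w(2) w1(2) that kn n i L_nonneg by auto
      moreover have "u1 j = x j" using u1(1) that kn by (simp add: joins_def)
      ultimately show ?thesis by simp
    qed
    show "w j = x j" if "k2 * n + int K \<le> j" for j
      using w(3)[of j] u2(1) that i L_nonneg by (simp add: joins_def)
  qed (use w xa in auto)
  moreover define q where "q = k1 * n + n + p"
  have "mark (translate q w)"
  proof (rule mark_near[OF xv(1) _ _ xv(2)])
    show "translate q w \<in> X" using w by simp
    show "near H xv (translate q w)"
      unfolding near_def translate_apply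
    proof (intro allI impI)
      fix j :: int assume j: "\<bar>j\<bar> \<le> H"
      have "w (q + j) = w1 (q + j)" by (rule w(2)) (use j kn np K' i L_nonneg in \<open>auto simp: q_def\<close>)
      also have "\<dots> = y (q + j)" by (rule w1(3)) (use j kn np K' i L_nonneg n in \<open>auto simp: q_def\<close>)
      also have "\<dots> = translate ((k1 + 1) * n) y (p + j)"
        by (simp add: translate_apply q_def algebra_simps)
      also have "\<dots> = y (p + j)" by (simp only: per)
      also have "\<dots> = xv j" using yv j K' by (simp add: near_def translate_apply)
      finally show "xv j = w (q + j)" by simp
    qed
  qed
  moreover have "H \<le> q" "q + H \<le> k2 * n + int K"
    using kn np K' n by (auto simp: q_def)
  ultimately have "inserts (k2 * n + int K) x" unfolding inserts_def by blast
  then show False using xa(1) by (simp add: avoiders_def)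
qed

text \<open>Since a minimizing fibre has no avoiders, compactness gives a block of the image over which no
  point avoids insertion of a mark.\<close>

lemma magic_word:
  obtains x0 and K :: nat where "x0 \<in> X"
    "\<And>x. x \<in> X \<Longrightarrow> near (int K) (\<pi> x) (\<pi> x0) \<Longrightarrow> inserts (int K) x"
proof -
  obtain xv where "xv \<in> X" using mark_ex by blast
  then obtain x0 where x0: "x0 \<in> X"
    "\<And>x. x \<in> X \<Longrightarrow> card (class_of X \<pi> ` avoiders (\<pi> x0)) \<le> card (class_of X \<pi> ` avoiders (\<pi> x))"
    using ex_has_least_nat[of "\<lambda>x. x \<in> X" xv "\<lambda>x. card (class_of X \<pi> ` avoiders (\<pi> x))"] by blast
  have "\<exists>n. \<forall>x\<in>near_avoiders (\<pi> x0) n. False"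
    by (rule shrinks_to_eventually[OF shrinks_to_avoiders]) (use avoiders_collapse[OF x0(2)] in simp)
  then obtain K :: nat where "near_avoiders (\<pi> x0) K = {}" by blast
  then have "inserts (int K) x" if "x \<in> X" "near (int K) (\<pi> x) (\<pi> x0)" for x
    using that by (auto simp: near_avoiders_def)
  then show ?thesis by (rule that[OF x0(1)])
qed

text \<open>The detours inserting a mark have disjoint and well separated supports, so all of them can be made at
  once. Between consecutive detours the new point agrees with \<open>x\<close>, hence it is equivalent to \<open>x\<close>.\<close>

lemma recurrently_marked_representative:
  assumes x: "x \<in> X" and n: "K + 2 * L < n" "0 \<le> K"
    and ins: "\<And>k. inserts K (translate (k * n) x)"
  obtains x' where "class_equiv X \<pi> x x'" "\<And>m. \<exists>p\<ge>m. mark (translate p x')"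
proof -
  have n0: "0 < n" using n L_nonneg by linarith
  have "\<exists>u q. joins (k * n) (k * n + K) x x u \<and> k * n + H \<le> q \<and> q + H \<le> k * n + K \<and> mark (translate q u)" for k
  proof -
    obtain u q where u: "joins 0 K (translate (k * n) x) (translate (k * n) x) u" "H \<le> q" "q + H \<le> K" "mark (translate q u)"
      using ins[of k] unfolding inserts_def by blast
    have "joins (k * n) (k * n + K) x x (translate (- (k * n)) u)"
      using joins_translate[OF u(1) x] by simp
    moreover have "mark (translate (k * n + q) (translate (- (k * n)) u))" using u(4) by simp
    moreover have "k * n + H \<le> k * n + q" "k * n + q + H \<le> k * n + K" using u by auto
    ultimately show ?thesis by blast
  qed
  then obtain u q where u: "\<And>k. joins (k * n) (k * n + K) x x (u k)"
    and q: "\<And>k. k * n + H \<le> q k" "\<And>k. q k + H \<le> k * n + K" "\<And>k. mark (translate (q k) (u k))"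
    by metis
  have uX: "u k \<in> X" "\<pi> (u k) = \<pi> x" for k using u[of k] by (auto simp: joins_def)
  have ul: "u k j = x j" if "j \<le> k * n" for k j using u[of k] that by (simp add: joins_def)
  have ur: "u k j = x j" if "k * n + K \<le> j" for k j using u[of k] that by (simp add: joins_def)
  define x' where "x' = (\<lambda>j. u (j div n) j)"
  have div_eq: "j div n = k" if "k * n \<le> j" "j < k * n + n" for j k
    by (rule int_div_pos_eq[of _ _ _ "j - k * n"]) (use that in \<open>auto simp: mult.commute\<close>)
  \<comment> \<open>A window ending in the period of \<open>k\<close> may begin in the previous one, but there the previous detour
    is already over; this is why the overlap \<open>2 * L\<close> extends to the left.\<close>
  have x'u: "x' j = u k j" if "k * n - 2 * L \<le> j" "j < k * n + n" for j k
  proof (cases "k * n \<le> j")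
    case True
    then show ?thesis using div_eq that by (simp add: x'_def)
  next
    case False
    have kn: "(k - 1) * n = k * n - n" by (simp add: algebra_simps)
    have "j div n = k - 1" by (rule div_eq) (use False that n kn in auto)
    moreover have "u (k - 1) j = x j" by (rule ur) (use False that n kn in auto)
    ultimately show ?thesis using ul[of j k] False by (simp add: x'_def)
  qed
  have window: "\<exists>k. \<forall>j. i - L \<le> j \<and> j \<le> i + L \<longrightarrow> x' j = u k j" for i
  proof -
    define k where "k = (i + L) div n"
    have "k * n \<le> i + L" "i + L < k * n + n"
      using n0 pos_mod_sign[of n "i + L"] pos_mod_bound[of n "i + L"] div_mult_mod_eq[of "i + L" n]
      unfolding k_def by linarith+
    then have "\<forall>j. i - L \<le> j \<and> j \<le> i + L \<longrightarrow> x' j = u k j"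
      by (intro allI impI x'u) auto
    then show ?thesis by blast
  qed
  have x'X: "x' \<in> X"
    by (rule locally_in) (use window uX(1) in blast)
  have "\<pi> x' i = \<pi> x i" for i
  proof -
    obtain k where k: "\<forall>j. i - L \<le> j \<and> j \<le> i + L \<longrightarrow> x' j = u k j" using window by blast
    have "\<pi> x' i = \<pi> (u k) i"
      by (rule sliding_code_local[OF code x'X uX(1)]) (use k in auto)
    then show ?thesis using uX(2) by simp
  qed
  then have pi: "\<pi> x = \<pi> x'" by auto
  have kn: "\<bar>m\<bar> \<le> \<bar>m\<bar> * n" for m :: int
    using n0 by (simp add: mult_le_cancel_left1)
  have meets: "\<exists>i\<ge>m. st x i = st x' i" for m
  proof (intro exI[of _ "\<bar>m + L\<bar> * n - L"] conjI)
    show "m \<le> \<bar>m + L\<bar> * n - L" using kn[of "m + L"] by linarith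
    show "st x (\<bar>m + L\<bar> * n - L) = st x' (\<bar>m + L\<bar> * n - L)"
    proof (rule st_eqI)
      fix j assume "\<bar>m + L\<bar> * n - L - L \<le> j" "j \<le> \<bar>m + L\<bar> * n - L + L"
      then show "x j = x' j"
        using x'u[of "\<bar>m + L\<bar>" j] ul[of j "\<bar>m + L\<bar>"] n0 by auto
    qed
  qed
  have meets': "\<exists>i\<ge>m. st x' i = st x i" for m using meets[of m] by metis
  have "class_equiv X \<pi> x x'"
    unfolding class_equiv_def
    using leads_to_if_meets[OF x x'X pi meets] leads_to_if_meets[OF x'X x pi[symmetric] meets'] by simp
  moreover have "\<exists>p\<ge>m. mark (translate p x')" for m
  proof (intro exI[of _ "q \<bar>m\<bar>"] conjI)
    show "m \<le> q \<bar>m\<bar>" using q(1)[of "\<bar>m\<bar>"] kn[of m] H_nonneg by linarith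
    show "mark (translate (q \<bar>m\<bar>) x')"
    proof (rule mark_near[OF _ _ _ q(3)[of "\<bar>m\<bar>"]])
      show "near H (translate (q \<bar>m\<bar>) (u \<bar>m\<bar>)) (translate (q \<bar>m\<bar>) x')"
        unfolding near_def translate_apply
      proof (intro allI impI)
        fix j :: int assume "\<bar>j\<bar> \<le> H"
        then have "\<bar>m\<bar> * n - 2 * L \<le> q \<bar>m\<bar> + j" "q \<bar>m\<bar> + j < \<bar>m\<bar> * n + n"
          using q(1,2)[of "\<bar>m\<bar>"] n L_nonneg by linarith+
        then show "u \<bar>m\<bar> (q \<bar>m\<bar> + j) = x' (q \<bar>m\<bar> + j)" using x'u by simp
      qed
    qed (use uX x'X in auto)
  qed
  ultimately show ?thesis using that by blast
qed

end

lemma (in sft_code) shrinks_to_fibre: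
  assumes f: "sliding_code X L f"
  shows "shrinks_to (\<lambda>n. {x\<in>X. near (int n) (f x) y}) {x\<in>X. f x = y}"
  unfolding shrinks_to_def
proof (intro conjI allI impI)
  show "decseq (\<lambda>n. {x\<in>X. near (int n) (f x) y})"
  proof (rule decseq_SucI, rule subsetI)
    fix n x assume "x \<in> {x\<in>X. near (int (Suc n)) (f x) y}"
    then show "x \<in> {x\<in>X. near (int n) (f x) y}"
      using near_mono[of "int (Suc n)" "f x" y "int n"] by simp
  qed
  fix g x
  assume asm: "(\<forall>n. g n \<in> {x\<in>X. near (int n) (f x) y}) \<and> x \<in> X \<and> (\<forall>K. \<exists>n. K \<le> int n \<and> near K (g n) x)"
  then have g: "\<And>n. g n \<in> X" "\<And>n. near (int n) (f (g n)) y"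
    and x: "x \<in> X" and cl: "\<And>K. \<exists>n. K \<le> int n \<and> near K (g n) x"
    by blast+
  have "f x j = y j" for j
  proof -
    obtain n where n: "\<bar>j\<bar> + L \<le> int n" "near (\<bar>j\<bar> + L) (g n) x" using cl by blast
    have "f (g n) j = f x j"
      using sliding_code_near[OF f g(1) x n(2)] by (simp add: near_def)
    moreover have "\<bar>j\<bar> \<le> int n" using n(1) L_nonneg by linarith
    then have "f (g n) j = y j" using g(2)[of n] by (simp add: near_def)
    ultimately show ?thesis by simp
  qed
  then show "x \<in> {x\<in>X. f x = y}" using x by auto
qed (auto simp: near_def)

section \<open>Two codes in a row\<close>

locale code_tower = sft_code X A L \<pi> + down: sft_code Y B L \<psi>
  for X :: "(int \<Rightarrow> 'a) set" and A L and \<pi> :: "(int \<Rightarrow> 'a) \<Rightarrow> (int \<Rightarrow> 'c)"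
    and Y :: "(int \<Rightarrow> 'b) set" and B and \<psi> :: "(int \<Rightarrow> 'b) \<Rightarrow> (int \<Rightarrow> 'c)" +
  fixes \<phi> :: "(int \<Rightarrow> 'a) \<Rightarrow> (int \<Rightarrow> 'b)"
  assumes phi_code: "sliding_code X L \<phi>"
    and phi_onto: "\<phi> ` X = Y"
    and factor: "x \<in> X \<Longrightarrow> \<pi> x = \<psi> (\<phi> x)"
begin

lemma phi_in [simp]: "x \<in> X \<Longrightarrow> \<phi> x \<in> Y"
  using phi_onto by blast

text \<open>By \<open>rel_class_of_eq\<close> below, the number of these classes is the relative class count at \<open>y\<close>.\<close>

definition fibre_classes :: "(int \<Rightarrow> 'b) \<Rightarrow> (int \<Rightarrow> 'a) set set" where
  "fibre_classes y = class_of X \<pi> ` {x\<in>X. \<phi> x = y}"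

lemma finite_fibre_classes: "finite (fibre_classes y)"
  unfolding fibre_classes_def by (rule finite_classes[of _ "\<psi> y"]) (auto simp: factor)

lemma phi_joins:
  assumes "joins a b x x' u" "x \<in> X" "x' \<in> X"
  shows "down.joins (a - L) (b + L) (\<phi> x) (\<phi> x') (\<phi> u)"
proof -
  have u: "u \<in> X" "\<And>j. j \<le> a \<Longrightarrow> u j = x j" "\<And>j. b \<le> j \<Longrightarrow> u j = x' j" "\<pi> u = \<pi> x"
    using assms(1) by (auto simp: joins_def)
  have "\<phi> u j = \<phi> x j" if "j \<le> a - L" for j
    by (rule sliding_code_local[OF phi_code u(1) assms(2)]) (use u that in auto)
  moreover have "\<phi> u j = \<phi> x' j" if "b + L \<le> j" for j
    by (rule sliding_code_local[OF phi_code u(1) assms(3)]) (use u that in auto)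
  moreover have "\<psi> (\<phi> u) = \<psi> (\<phi> x)" using factor[OF u(1)] factor[OF assms(2)] u(4) by simp
  ultimately show ?thesis using u(1) by (simp add: down.joins_def)
qed

lemma phi_leads_to:
  assumes "leads_to X \<pi> x x'"
  shows "leads_to Y \<psi> (\<phi> x) (\<phi> x')"
proof (rule down.leads_toI)
  note * = leads_toD[OF assms]
  show "\<phi> x \<in> Y" "\<phi> x' \<in> Y" using * by auto
  show "\<psi> (\<phi> x) = \<psi> (\<phi> x')" using *(3) factor[OF *(1)] factor[OF *(2)] by simp
  fix m
  obtain b u where "joins (m + L) b x x' u" using *(4) by blast
  then have "down.joins (m + L - L) (b + L) (\<phi> x) (\<phi> x') (\<phi> u)" using phi_joins * by blast
  then show "\<exists>a b u. m \<le> a \<and> down.joins a b (\<phi> x) (\<phi> x') u" by force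
qed

lemma phi_class_equiv: "class_equiv X \<pi> x x' \<Longrightarrow> class_equiv Y \<psi> (\<phi> x) (\<phi> x')"
  using phi_leads_to by (simp add: class_equiv_def)

text \<open>The image of a bridge ends in \<open>\<phi> x'\<close>, and right asymptotic points of a \<open>\<psi>\<close>-fibre are equivalent.
  So the condition that a relative bridge imposes on its image is satisfied automatically.\<close>

lemma rel_leads_to_if_class_equiv:
  assumes "class_equiv X \<pi> x x'"
  shows "rel_leads_to X Y \<phi> \<psi> x x'"
proof -
  have x: "x \<in> X" "x' \<in> X" "\<pi> x = \<pi> x'" and lt: "leads_to X \<pi> x x'"
    using assms leads_toD by (auto simp: class_equiv_def)
  have y: "class_equiv Y \<psi> (\<phi> x) (\<phi> x')" using phi_class_equiv assms by blast
  have "\<exists>u. rel_bridge X Y \<phi> \<psi> m x x' u" for m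
  proof -
    obtain b u where b: "m < b" and u: "joins m b x x' u" using leads_toD(4)[OF lt] by blast
    have dj: "down.joins (m - L) (b + L) (\<phi> x) (\<phi> x') (\<phi> u)" using phi_joins u x by blast
    have uX: "u \<in> X" using u by (simp add: joins_def)
    have eq: "\<psi> (\<phi> x') = \<psi> (\<phi> u)"
      using x factor[OF x(1)] factor[OF x(2)] dj by (simp add: down.joins_def)
    have asym: "\<phi> x' j = \<phi> u j" if "b + L \<le> j" for j using dj that by (simp add: down.joins_def)
    have "class_equiv Y \<psi> (\<phi> x') (\<phi> u)"
      unfolding class_equiv_def
    proof
      show "leads_to Y \<psi> (\<phi> x') (\<phi> u)"
        by (rule down.leads_to_if_right_asymptotic[of _ _ "b + L"]) (use x uX eq asym in auto)
      show "leads_to Y \<psi> (\<phi> u) (\<phi> x')"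
        by (rule down.leads_to_if_right_asymptotic[of _ _ "b + L"]) (use x uX eq asym in auto)
    qed
    then have "rel_bridge X Y \<phi> \<psi> m x x' u"
      unfolding rel_bridge_def using b u y by (auto simp: joins_def)
    then show ?thesis by blast
  qed
  then show ?thesis using x y unfolding rel_leads_to_def by blast
qed

lemma leads_to_if_rel_leads_to:
  assumes "rel_leads_to X Y \<phi> \<psi> x x'"
  shows "leads_to X \<pi> x x'"
proof -
  have x: "x \<in> X" "x' \<in> X" and y: "class_equiv Y \<psi> (\<phi> x) (\<phi> x')"
    and br: "\<And>m. \<exists>u. rel_bridge X Y \<phi> \<psi> m x x' u"
    using assms unfolding rel_leads_to_def by blast+
  have same: "\<psi> y = \<psi> y'" if "class_equiv Y \<psi> y y'" for y y'
    using that down.leads_toD(3) unfolding class_equiv_def by blast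
  have pi: "\<pi> x = \<pi> x'" using same[OF y] factor[OF x(1)] factor[OF x(2)] by simp
  show ?thesis
  proof (rule leads_toI[OF x pi])
    fix m
    obtain u n where u: "u \<in> X" "\<forall>i\<le>m. u i = x i" "\<forall>i\<ge>n. u i = x' i" "class_equiv Y \<psi> (\<phi> x') (\<phi> u)"
      using br[of m] unfolding rel_bridge_def by blast
    have "\<pi> u = \<pi> x" using same[OF u(4)] factor[OF u(1)] factor[OF x(2)] pi by simp
    then have "joins m n x x' u" using u by (simp add: joins_def)
    then show "\<exists>a b u. m \<le> a \<and> joins a b x x' u" by blast
  qed
qed

lemma rel_class_of_eq: "rel_class_of X Y \<phi> \<psi> x = class_of X \<pi> x"
proof -
  have "rel_class_equiv X Y \<phi> \<psi> x x' \<longleftrightarrow> class_equiv X \<pi> x x'" for x'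
    using rel_leads_to_if_class_equiv leads_to_if_rel_leads_to class_equiv_sym
    unfolding rel_class_equiv_def class_equiv_def by meson
  then show ?thesis by (simp add: rel_class_of_def class_of_def)
qed

text \<open>A cut through the paths over \<open>y\<close> is visible in a block of \<open>y\<close>. By irreducibility of \<open>Y\<close> some point
  repeats this block forever, and the number of classes in its fibre is at most the size of the cut.\<close>

lemma cut_ge:
  assumes e: "\<And>y. y \<in> Y \<Longrightarrow> e \<le> card (fibre_classes y)"
    and y: "y \<in> Y" and C: "finite C" and ab: "\<And>i s. (i, s) \<in> C \<Longrightarrow> a \<le> i \<and> i \<le> b"
    and cut: "\<And>x. x \<in> X \<Longrightarrow> \<phi> x = y \<Longrightarrow> \<exists>(i, s)\<in>C. routes a b i s x"
  shows "e \<le> card C"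
proof -
  obtain k :: nat where k: "\<And>x. x \<in> {x\<in>X. near (int k) (\<phi> x) y} \<Longrightarrow> \<exists>(i, s)\<in>C. routes a b i s x"
    using transversal_extends[OF shrinks_to_fibre[OF phi_code, of y], where G = C] ab cut by blast
  obtain y' n p where y': "y' \<in> Y" "2 * int k < p" "p + 2 * int k < n" "\<And>k. translate (k * n) y' = y'"
    "near (int k) y' y"
    by (rule down.periodic_point[OF y y, of "int k"]) (simp, rule that)
  have n0: "0 < n" using y' by linarith
  have "finite (fibre_classes y') \<and> card (fibre_classes y') \<le> card C"
    unfolding fibre_classes_def
  proof (rule card_classes_le[OF _ _ C ab])
    fix m :: int
    show "\<exists>p\<ge>m. \<forall>x\<in>{x\<in>X. \<phi> x = y'}. \<exists>(i, s)\<in>C. routes (p + a) (p + b) (p + i) s x"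
    proof (intro exI[of _ "\<bar>m\<bar> * n"] conjI ballI)
      show "m \<le> \<bar>m\<bar> * n" using n0 by (smt (verit) mult_le_cancel_left1)
      fix x assume "x \<in> {x\<in>X. \<phi> x = y'}"
      then have x: "x \<in> X" "\<phi> x = y'" by auto
      have "\<phi> (translate (\<bar>m\<bar> * n) x) = y'"
        using sliding_code_translate[OF phi_code x(1)] x(2) y'(4) by simp
      then have "translate (\<bar>m\<bar> * n) x \<in> {x\<in>X. near (int k) (\<phi> x) y}" using x(1) y'(5) by simp
      then obtain i s where "(i, s) \<in> C" "routes a b i s (translate (\<bar>m\<bar> * n) x)" using k by blast
      then show "\<exists>(i, s)\<in>C. routes (\<bar>m\<bar> * n + a) (\<bar>m\<bar> * n + b) (\<bar>m\<bar> * n + i) s x"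
        using routes_translate[OF _ x(1)] by blast
    qed
  qed (auto simp: factor)
  then show ?thesis using e[OF y'(1)] by simp
qed

end

section \<open>Equivalent points of the middle shift see the same classes\<close>

text \<open>Here \<open>e\<close> is the relative class degree and \<open>G\<close> is a transversal of that size for the paths over a
  block of a point \<open>y0\<close> attaining it.\<close>

locale minimal_tower = code_tower X A L \<pi> Y B \<psi> \<phi>
  for X :: "(int \<Rightarrow> 'a) set" and A L and \<pi> :: "(int \<Rightarrow> 'a) \<Rightarrow> (int \<Rightarrow> 'c)"
    and Y :: "(int \<Rightarrow> 'b) set" and B and \<psi> :: "(int \<Rightarrow> 'b) \<Rightarrow> (int \<Rightarrow> 'c)"
    and \<phi> :: "(int \<Rightarrow> 'a) \<Rightarrow> (int \<Rightarrow> 'b)" +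
  fixes e :: nat and y0 :: "int \<Rightarrow> 'b" and K :: int and G :: "(int \<times> 'a list) set"
  assumes e_le: "y \<in> Y \<Longrightarrow> e \<le> card (fibre_classes y)"
    and y0: "y0 \<in> Y" and K_nonneg: "0 \<le> K"
    and finite_G: "finite G" and card_G: "card G \<le> e"
    and G_bounds: "(i, s) \<in> G \<Longrightarrow> 0 \<le> i \<and> i \<le> K"
    and G_transversal: "x \<in> X \<Longrightarrow> near K (\<phi> x) y0 \<Longrightarrow> \<exists>(i, s)\<in>G. routes 0 K i s x"
begin

definition hit :: "(int \<Rightarrow> 'b) \<Rightarrow> int \<Rightarrow> bool" where
  "hit y p \<longleftrightarrow> near K (translate p y) y0"

definition recurrent :: "(int \<Rightarrow> 'b) \<Rightarrow> bool" where
  "recurrent y \<longleftrightarrow> (\<forall>m. \<exists>p\<ge>m. hit y p)"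

lemma routes_at_hit:
  assumes x: "x \<in> X" and "hit (\<phi> x) p"
  shows "\<exists>g\<in>G. routes p (p + K) (p + fst g) (snd g) x"
proof -
  have "\<phi> (translate p x) = translate p (\<phi> x)" by (rule sliding_code_translate[OF phi_code x])
  then have "near K (\<phi> (translate p x)) y0" using assms(2) by (simp add: hit_def)
  then obtain i s where g: "(i, s) \<in> G" "routes 0 K i s (translate p x)"
    using G_transversal[OF translate_in[OF x]] by blast
  have "routes (p + 0) (p + K) (p + i) s x" by (rule routes_translate[OF g(2) x])
  then show ?thesis using g(1) by force
qed

lemma card_fibre_classes_recurrent:
  assumes y: "y \<in> Y" "recurrent y"
  shows "card (fibre_classes y) = e" "card G = e"
proof -
  have "finite (fibre_classes y) \<and> card (fibre_classes y) \<le> card G"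
    unfolding fibre_classes_def
  proof (rule card_classes_le[OF _ _ finite_G G_bounds])
    fix m :: int
    obtain p where p: "m \<le> p" "hit y p" using y(2) unfolding recurrent_def by blast
    show "\<exists>p\<ge>m. \<forall>x\<in>{x\<in>X. \<phi> x = y}. \<exists>(i, s)\<in>G. routes (p + 0) (p + K) (p + i) s x"
    proof (intro exI[of _ p] conjI ballI p(1))
      fix x assume "x \<in> {x\<in>X. \<phi> x = y}"
      then obtain g where "g \<in> G" "routes p (p + K) (p + fst g) (snd g) x"
        using routes_at_hit[of x p] p(2) by auto
      then show "\<exists>(i, s)\<in>G. routes (p + 0) (p + K) (p + i) s x" by force
    qed
  qed (auto simp: factor)
  then show "card (fibre_classes y) = e" "card G = e" using e_le[OF y(1)] card_G by auto
qed

text \<open>Minimality of \<open>e\<close> turns the eventual injectivity of labels into bijectivity.\<close>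

lemma bijective_labels:
  assumes y: "y \<in> Y" "recurrent y"
    and T: "T \<subseteq> {x\<in>X. \<phi> x = y}" "inj_on (class_of X \<pi>) T" "fibre_classes y = class_of X \<pi> ` T"
  obtains m where "\<And>p. m \<le> p \<Longrightarrow> hit y p \<Longrightarrow>
    \<exists>l. bij_betw l T G \<and> (\<forall>x\<in>T. routes p (p + K) (p + fst (l x)) (snd (l x)) x)"
proof -
  have fin: "finite T" "card T = card G"
    using T card_fibre_classes_recurrent[OF y] finite_fibre_classes[of y] finite_image_iff card_image by metis+
  have TX: "T \<subseteq> X" "\<And>x. x \<in> T \<Longrightarrow> \<pi> x = \<psi> y" "\<And>x. x \<in> T \<Longrightarrow> \<phi> x = y" using T factor by auto
  obtain m where m: "\<And>x x' a b i s. x \<in> T \<Longrightarrow> x' \<in> T \<Longrightarrow> m \<le> a \<Longrightarrow> a \<le> i \<Longrightarrow> i \<le> b \<Longrightarrow>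
    routes a b i s x \<Longrightarrow> routes a b i s x' \<Longrightarrow> x = x'"
    by (rule eventually_no_common_route[of T "\<psi> y"]) (use fin TX T(2) in auto)
  show ?thesis
  proof (rule that[of m])
    fix p assume p: "m \<le> p" "hit y p"
    have "\<forall>x\<in>T. \<exists>g\<in>G. routes p (p + K) (p + fst g) (snd g) x"
      using routes_at_hit p(2) TX by blast
    then obtain l where l: "\<And>x. x \<in> T \<Longrightarrow> l x \<in> G"
      "\<And>x. x \<in> T \<Longrightarrow> routes p (p + K) (p + fst (l x)) (snd (l x)) x" by metis
    have inj: "inj_on l T"
    proof (rule inj_onI)
      fix x x' assume *: "x \<in> T" "x' \<in> T" "l x = l x'"
      have "0 \<le> fst (l x)" "fst (l x) \<le> K"
        using l(1)[OF *(1)] G_bounds[of "fst (l x)" "snd (l x)"] by auto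
      then show "x = x'"
        using m[OF *(1,2) p(1) _ _ l(2)[OF *(1)]] l(2)[OF *(2)] *(3) by simp
    qed
    have "l ` T = G"
      using l(1) fin finite_G card_image[OF inj] by (intro card_subset_eq) auto
    then show "\<exists>l. bij_betw l T G \<and> (\<forall>x\<in>T. routes p (p + K) (p + fst (l x)) (snd (l x)) x)"
      using inj l(2) unfolding bij_betw_def by blast
  qed
qed

text \<open>Follow \<open>y\<close> past an occurrence of the block at \<open>p\<close>, then change to \<open>y'\<close> and pass another occurrence
  at \<open>p'\<close>. At the two occurrences the transversal is labelled by the representatives \<open>T\<close> and \<open>T'\<close>. A path
  over this point that is routed at \<open>p\<close> through the label of \<open>t\<close> and at \<open>p'\<close> through that of \<open>t'\<close> shows
  that \<open>t\<close> leads to \<open>t'\<close>. Therefore the labels of \<open>T - J\<close> at \<open>p\<close>, together with the labels at \<open>p'\<close> of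
  those members of \<open>T'\<close> to which some member of \<open>J\<close> leads, form a cut, whose size is at least
  \<open>e = card T\<close>.\<close>

lemma hall_representatives:
  assumes yy: "leads_to Y \<psi> y y'" and rec: "recurrent y" "recurrent y'"
    and T: "T \<subseteq> {x\<in>X. \<phi> x = y}" "inj_on (class_of X \<pi>) T" "fibre_classes y = class_of X \<pi> ` T"
    and T': "T' \<subseteq> {x\<in>X. \<phi> x = y'}" "inj_on (class_of X \<pi>) T'" "fibre_classes y' = class_of X \<pi> ` T'"
    and J: "J \<subseteq> T"
  shows "card J \<le> card {x'\<in>T'. \<exists>x\<in>J. leads_to X \<pi> x x'}"
proof -
  define N where "N = {x'\<in>T'. \<exists>x\<in>J. leads_to X \<pi> x x'}"
  have Y: "y \<in> Y" "y' \<in> Y" "\<psi> y = \<psi> y'" using down.leads_toD[OF yy] by auto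
  have TX: "\<And>x. x \<in> T \<Longrightarrow> x \<in> X \<and> \<phi> x = y \<and> \<pi> x = \<psi> y" using T(1) factor by auto
  have TX': "\<And>x. x \<in> T' \<Longrightarrow> x \<in> X \<and> \<phi> x = y' \<and> \<pi> x = \<psi> y" using T'(1) factor Y(3) by auto
  have cG: "card G = e" by (rule card_fibre_classes_recurrent(2)[OF Y(1) rec(1)])
  have fin: "finite T" "finite T'"
    using T T' finite_fibre_classes finite_image_iff by metis+
  obtain m where m: "\<And>p. m \<le> p \<Longrightarrow> hit y p \<Longrightarrow>
    \<exists>l. bij_betw l T G \<and> (\<forall>x\<in>T. routes p (p + K) (p + fst (l x)) (snd (l x)) x)"
    by (rule bijective_labels[OF Y(1) rec(1) T]) (rule that)
  obtain m' where m': "\<And>p. m' \<le> p \<Longrightarrow> hit y' p \<Longrightarrow>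
    \<exists>l. bij_betw l T' G \<and> (\<forall>x\<in>T'. routes p (p + K) (p + fst (l x)) (snd (l x)) x)"
    by (rule bijective_labels[OF Y(2) rec(2) T']) (rule that)
  define Q where "Q M x \<longleftrightarrow> (\<forall>x'\<in>T'. \<forall>a b u. M \<le> a \<longrightarrow> joins a b x x' u \<longrightarrow> leads_to X \<pi> x x')"
    for M :: int and x
  have "\<exists>M. Q M x" if x: "x \<in> T" for x
  proof -
    obtain M where "\<And>r a b u. r \<in> T' \<Longrightarrow> M \<le> a \<Longrightarrow> joins a b x r u \<Longrightarrow> leads_to X \<pi> x r"
      by (rule leads_to_if_joins_late[OF fin(2), of x]) (use TX TX' x in auto)
    then show ?thesis unfolding Q_def by blast
  qed
  moreover have "Q M' x" if "Q M x" "M \<le> M'" for M M' x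
    using that unfolding Q_def by (meson order_trans)
  ultimately obtain M where M: "\<And>x. x \<in> T \<Longrightarrow> Q M x"
    using finite_common_bound[OF fin(1), of Q] by blast
  obtain p where p: "max m M \<le> p" "hit y p" using rec(1) unfolding recurrent_def by blast
  obtain b w where b: "p + K < b" and w: "down.joins (p + K) b y y' w"
    using down.leads_toD(4)[OF yy] by blast
  obtain p' where p': "max m' (b + K + 2 * L) \<le> p'" "hit y' p'" using rec(2) unfolding recurrent_def by blast
  have wY: "w \<in> Y" using w by (simp add: down.joins_def)
  have wp: "hit w p"
    unfolding hit_def near_def translate_apply
  proof (intro allI impI)
    fix j :: int assume j: "\<bar>j\<bar> \<le> K"
    then have "w (p + j) = y (p + j)" using w by (simp add: down.joins_def)
    then show "w (p + j) = y0 j" using p(2) j by (simp add: hit_def near_def translate_apply)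
  qed
  have wp': "hit w p'"
    unfolding hit_def near_def translate_apply
  proof (intro allI impI)
    fix j :: int assume j: "\<bar>j\<bar> \<le> K"
    then have "b \<le> p' + j" using p'(1) L_nonneg by linarith
    then have "w (p' + j) = y' (p' + j)" using w by (simp add: down.joins_def)
    then show "w (p' + j) = y0 j" using p'(2) j by (simp add: hit_def near_def translate_apply)
  qed
  obtain l where l: "bij_betw l T G" "\<And>x. x \<in> T \<Longrightarrow> routes p (p + K) (p + fst (l x)) (snd (l x)) x"
    using m[of p] p by auto
  obtain l' where l': "bij_betw l' T' G" "\<And>x. x \<in> T' \<Longrightarrow> routes p' (p' + K) (p' + fst (l' x)) (snd (l' x)) x"
    using m'[of p'] p' by auto
  have Gb: "0 \<le> fst g" "fst g \<le> K" if "g \<in> G" for g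
    using G_bounds[of "fst g" "snd g"] that by auto
  have pp': "p + K + 2 * L \<le> p'" using p'(1) b K_nonneg by linarith
  \<comment> \<open>The mixed cut: labels outside \<open>J\<close> at \<open>p\<close>, labels of the successors of \<open>J\<close> at \<open>p'\<close>.\<close>
  define C where "C = (\<lambda>g. (p + fst g, snd g)) ` (G - l ` J) \<union> (\<lambda>g. (p' + fst g, snd g)) ` (l' ` N)"
  have lN: "l' ` N \<subseteq> G" using l'(1) unfolding N_def bij_betw_def by blast
  have finN: "finite N" using fin(2) by (simp add: N_def)
  have "e \<le> card C"
  proof (rule cut_ge[OF e_le wY])
    show "finite C" using finite_G finN by (simp add: C_def)
    show "p \<le> i \<and> i \<le> p' + K" if "(i, s) \<in> C" for i s
    proof -
      from that lN obtain g where "g \<in> G" "i = p + fst g \<or> i = p' + fst g"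
        unfolding C_def by auto
      then show ?thesis using Gb[of g] pp' L_nonneg K_nonneg by linarith
    qed
    fix x assume x: "x \<in> X" "\<phi> x = w"
    have pix: "\<pi> x = \<psi> y" using x factor w by (simp add: down.joins_def)
    obtain g where g: "g \<in> G" "routes p (p + K) (p + fst g) (snd g) x"
      using routes_at_hit[OF x(1)] wp x(2) by blast
    show "\<exists>(i, s)\<in>C. routes p (p' + K) i s x"
    proof (cases "g \<in> l ` J")
      case False
      then have "(p + fst g, snd g) \<in> C" using g(1) by (auto simp: C_def)
      moreover have "routes p (p' + K) (p + fst g) (snd g) x"
        by (rule routes_mono[OF g(2)]) (use pp' L_nonneg K_nonneg in auto)
      ultimately show ?thesis by blast
    next
      case True
      then obtain t where t: "t \<in> J" "g = l t" by blast
      then have tT: "t \<in> T" using J by blast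
      obtain g' where g': "g' \<in> G" "routes p' (p' + K) (p' + fst g') (snd g') x"
        using routes_at_hit[OF x(1)] wp' x(2) by blast
      obtain t' where t': "t' \<in> T'" "g' = l' t'" using g'(1) l'(1) unfolding bij_betw_def by blast
      obtain u where u: "joins p (p + K) t x u"
        by (rule joins_if_common_route[OF l(2)[OF tT] g(2)[unfolded t(2)]])
          (use TX[OF tT] pix Gb[OF g(1)] t(2) in auto)
      obtain v where v: "joins p' (p' + K) x t' v"
        by (rule joins_if_common_route[OF g'(2)[unfolded t'(2)] l'(2)[OF t'(1)]])
          (use TX'[OF t'(1)] pix Gb[OF g'(1)] t'(2) in auto)
      obtain v' where "joins p (p' + K) t t' v'"
        by (rule joins_trans[OF u v]) (use TX[OF tT] pix pp' K_nonneg in auto)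
      then have "leads_to X \<pi> t t'" using M[OF tT] t'(1) p(1) unfolding Q_def by auto
      then have "t' \<in> N" using t(1) t'(1) by (auto simp: N_def)
      then have "(p' + fst g', snd g') \<in> C" using t'(2) by (auto simp: C_def)
      moreover have "routes p (p' + K) (p' + fst g') (snd g') x"
        by (rule routes_mono[OF g'(2)]) (use pp' L_nonneg K_nonneg in auto)
      ultimately show ?thesis by blast
    qed
  qed
  also have "card C \<le> card (G - l ` J) + card N"
  proof -
    have "card C \<le> card ((\<lambda>g. (p + fst g, snd g)) ` (G - l ` J)) + card ((\<lambda>g. (p' + fst g, snd g)) ` (l' ` N))"
      unfolding C_def by (rule card_Un_le)
    also have "\<dots> \<le> card (G - l ` J) + card (l' ` N)"
      using finite_G finN by (intro add_mono card_image_le) auto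
    also have "\<dots> \<le> card (G - l ` J) + card N"
      using card_image_le[OF finN] by simp
    finally show ?thesis .
  qed
  also have "card (G - l ` J) = e - card J"
  proof -
    have "inj_on l J" using l(1) J inj_on_subset unfolding bij_betw_def by blast
    then have "card (l ` J) = card J" by (rule card_image)
    moreover have "l ` J \<subseteq> G" using l(1) J unfolding bij_betw_def by blast
    ultimately show ?thesis using cG finite_G by (simp add: card_Diff_subset finite_subset)
  qed
  finally have "e \<le> e - card J + card N" .
  moreover have "card J \<le> e"
    using card_mono[OF fin(1) J] bij_betw_same_card[OF l(1)] cG by simp
  ultimately show ?thesis by (simp add: N_def)
qed

definition class_le :: "(int \<Rightarrow> 'a) set \<Rightarrow> (int \<Rightarrow> 'a) set \<Rightarrow> bool" where
  "class_le c c' \<longleftrightarrow> (\<exists>x x'. x \<in> X \<and> x' \<in> X \<and> c = class_of X \<pi> x \<and> c' = class_of X \<pi> x' \<and> leads_to X \<pi> x x')"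

lemma class_le_iff:
  assumes "x \<in> X" "x' \<in> X"
  shows "class_le (class_of X \<pi> x) (class_of X \<pi> x') \<longleftrightarrow> leads_to X \<pi> x x'"
proof
  assume "class_le (class_of X \<pi> x) (class_of X \<pi> x')"
  then obtain u u' where u: "u \<in> X" "u' \<in> X" "class_of X \<pi> x = class_of X \<pi> u"
    "class_of X \<pi> x' = class_of X \<pi> u'" "leads_to X \<pi> u u'"
    unfolding class_le_def by blast
  then have "leads_to X \<pi> x u" "leads_to X \<pi> u' x'"
    using class_of_eq_iff assms by (auto simp: class_equiv_def)
  then show "leads_to X \<pi> x x'" using u(5) leads_to_trans by blast
next
  assume "leads_to X \<pi> x x'"
  then show "class_le (class_of X \<pi> x) (class_of X \<pi> x')" using assms unfolding class_le_def by blast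
qed

lemma hall_classes:
  assumes yy: "leads_to Y \<psi> y y'" and rec: "recurrent y" "recurrent y'"
    and J: "J \<subseteq> fibre_classes y"
  shows "card J \<le> card {c'\<in>fibre_classes y'. \<exists>c\<in>J. class_le c c'}"
proof -
  obtain T where T: "T \<subseteq> {x\<in>X. \<phi> x = y}" "inj_on (class_of X \<pi>) T" "fibre_classes y = class_of X \<pi> ` T"
    by (rule class_representatives[of "fibre_classes y" "{x\<in>X. \<phi> x = y}"]) (auto simp: fibre_classes_def)
  obtain T' where T': "T' \<subseteq> {x\<in>X. \<phi> x = y'}" "inj_on (class_of X \<pi>) T'" "fibre_classes y' = class_of X \<pi> ` T'"
    by (rule class_representatives[of "fibre_classes y'" "{x\<in>X. \<phi> x = y'}"]) (auto simp: fibre_classes_def)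
  define JT where "JT = {x\<in>T. class_of X \<pi> x \<in> J}"
  define NT where "NT = {x'\<in>T'. \<exists>x\<in>JT. leads_to X \<pi> x x'}"
  have JJ: "J = class_of X \<pi> ` JT" using J T(3) by (auto simp: JT_def)
  have "inj_on (class_of X \<pi>) JT" "inj_on (class_of X \<pi>) NT"
    using T(2) T'(2) by (auto simp: JT_def NT_def intro: inj_on_subset)
  then have cards: "card J = card JT" "card NT = card (class_of X \<pi> ` NT)"
    using JJ card_image by metis+
  have "card JT \<le> card NT"
    unfolding NT_def by (rule hall_representatives[OF yy rec T T']) (simp add: JT_def)
  also have "\<dots> \<le> card {c'\<in>fibre_classes y'. \<exists>c\<in>J. class_le c c'}"
    unfolding cards(2)
  proof (rule card_mono)
    show "finite {c'\<in>fibre_classes y'. \<exists>c\<in>J. class_le c c'}" using finite_fibre_classes by simp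
    show "class_of X \<pi> ` NT \<subseteq> {c'\<in>fibre_classes y'. \<exists>c\<in>J. class_le c c'}"
    proof
      fix c assume "c \<in> class_of X \<pi> ` NT"
      then obtain x' x where x: "x' \<in> T'" "c = class_of X \<pi> x'" "x \<in> JT" "leads_to X \<pi> x x'"
        unfolding NT_def by blast
      have "class_le (class_of X \<pi> x) c"
        using class_le_iff x leads_toD(1,2)[OF x(4)] by simp
      moreover have "class_of X \<pi> x \<in> J" using x(3) by (simp add: JT_def)
      moreover have "c \<in> fibre_classes y'" using x T'(3) by blast
      ultimately show "c \<in> {c'\<in>fibre_classes y'. \<exists>c\<in>J. class_le c c'}" by blast
    qed
  qed
  finally show ?thesis using cards(1) by simp
qed

text \<open>On classes the relation \<open>leads_to\<close> is a partial order, and Hall's condition holds in both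
  directions.\<close>

lemma fibre_classes_eq:
  assumes yy: "class_equiv Y \<psi> y y'" and rec: "recurrent y" "recurrent y'"
  shows "fibre_classes y = fibre_classes y'"
proof (rule hall_order_antisym[of _ _ class_le])
  have cls: "\<exists>x\<in>X. c = class_of X \<pi> x" if "c \<in> fibre_classes y \<union> fibre_classes y'" for c
    using that by (auto simp: fibre_classes_def)
  show "class_le c c" if "c \<in> fibre_classes y \<union> fibre_classes y'" for c
    using cls[OF that] class_le_iff class_equiv_refl by (auto simp: class_equiv_def)
  show "class_le c e" if cd: "class_le c d" and de: "class_le d e" for c d e
  proof -
    obtain x1 x2 where 1: "x1 \<in> X" "x2 \<in> X" "c = class_of X \<pi> x1" "d = class_of X \<pi> x2"
      using cd unfolding class_le_def by blast
    obtain x3 where 2: "x3 \<in> X" "e = class_of X \<pi> x3" using de unfolding class_le_def by blast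
    have "leads_to X \<pi> x1 x2" using cd 1 class_le_iff by simp
    moreover have "leads_to X \<pi> x2 x3" using de 1 2 class_le_iff by simp
    ultimately have "leads_to X \<pi> x1 x3" by (rule leads_to_trans)
    then show ?thesis using 1 2 class_le_iff by simp
  qed
  show "c = d" if c: "c \<in> fibre_classes y \<union> fibre_classes y'" and d: "d \<in> fibre_classes y \<union> fibre_classes y'"
    and le: "class_le c d" "class_le d c" for c d
  proof -
    obtain x where x: "x \<in> X" "c = class_of X \<pi> x" using cls c by blast
    obtain x' where x': "x' \<in> X" "d = class_of X \<pi> x'" using cls d by blast
    have "class_equiv X \<pi> x x'" using le class_le_iff x x' by (simp add: class_equiv_def)
    then show ?thesis using class_of_eq_iff[OF x(1)] x(2) x'(2) by simp
  qed
qed (use finite_fibre_classes hall_classes assms in \<open>auto simp: class_equiv_def\<close>)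

end

section \<open>Counting classes\<close>

context minimal_tower begin

interpretation marked: marked_code X A L \<pi> "\<lambda>u. near K (\<phi> u) y0" "K + L"
proof
  show "0 \<le> K + L" using K_nonneg L_nonneg by simp
  show "near K (\<phi> u') y0" if "u \<in> X" "u' \<in> X" "near (K + L) u u'" "near K (\<phi> u) y0" for u u'
    using sliding_code_near[OF phi_code that(1-3)] that(4) by (simp add: near_def)
  show "\<exists>x\<in>X. near K (\<phi> x) y0"
  proof -
    obtain x where "x \<in> X" "\<phi> x = y0" using y0 phi_onto by blast
    then show ?thesis by (auto simp: near_def)
  qed
qed

text \<open>Each of these classes has a member whose image is recurrent and equivalent to \<open>y\<close>. The fibres over
  all such images meet the same \<open>e\<close> classes.\<close>

lemma few_classes_over_each_class:
  assumes rep: "\<And>x. x \<in> X \<Longrightarrow> \<pi> x = z \<Longrightarrow> \<exists>x'. class_equiv X \<pi> x x' \<and> recurrent (\<phi> x')"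
    and y: "y \<in> Y"
  shows "card {c \<in> class_of X \<pi> ` {x\<in>X. \<pi> x = z}. \<exists>x\<in>c. class_equiv Y \<psi> y (\<phi> x)} \<le> e"
proof -
  let ?\<C> = "{c \<in> class_of X \<pi> ` {x\<in>X. \<pi> x = z}. \<exists>x\<in>c. class_equiv Y \<psi> y (\<phi> x)}"
  have pick: "\<exists>x\<in>X. c = class_of X \<pi> x \<and> recurrent (\<phi> x) \<and> class_equiv Y \<psi> y (\<phi> x)"
    if c: "c \<in> ?\<C>" for c
  proof -
    obtain x1 x2 where x1: "x1 \<in> X" "\<pi> x1 = z" "c = class_of X \<pi> x1"
      and x2: "x2 \<in> c" "class_equiv Y \<psi> y (\<phi> x2)" using c by blast
    have 12: "class_equiv X \<pi> x1 x2" using x1(3) x2(1) by (simp add: class_of_def)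
    obtain x3 where x3: "class_equiv X \<pi> x1 x3" "recurrent (\<phi> x3)" using rep[OF x1(1,2)] by blast
    have "x3 \<in> X" using x3(1) leads_toD(2) unfolding class_equiv_def by blast
    moreover have "c = class_of X \<pi> x3" using class_of_eq_iff[OF x1(1)] x1(3) x3(1) by simp
    moreover have "class_equiv Y \<psi> (\<phi> x2) (\<phi> x3)"
      using phi_class_equiv class_equiv_trans[OF class_equiv_sym[OF 12] x3(1)] .
    then have "class_equiv Y \<psi> y (\<phi> x3)" by (rule down.class_equiv_trans[OF x2(2)])
    ultimately show ?thesis using x3(2) by blast
  qed
  show ?thesis
  proof (cases "?\<C> = {}")
    case False
    then obtain x where x: "x \<in> X" "recurrent (\<phi> x)" "class_equiv Y \<psi> y (\<phi> x)" using pick by blast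
    have "?\<C> \<subseteq> fibre_classes (\<phi> x)"
    proof
      fix c assume "c \<in> ?\<C>"
      then obtain x' where x': "x' \<in> X" "c = class_of X \<pi> x'" "recurrent (\<phi> x')" "class_equiv Y \<psi> y (\<phi> x')"
        using pick by blast
      have "class_equiv Y \<psi> (\<phi> x') (\<phi> x)"
        by (rule down.class_equiv_trans[OF down.class_equiv_sym[OF x'(4)] x(3)])
      then have "fibre_classes (\<phi> x') = fibre_classes (\<phi> x)"
        by (rule fibre_classes_eq[OF _ x'(3) x(2)])
      moreover have "c \<in> fibre_classes (\<phi> x')" using x' by (simp add: fibre_classes_def)
      ultimately show "c \<in> fibre_classes (\<phi> x)" by simp
    qed
    then have "card ?\<C> \<le> card (fibre_classes (\<phi> x))" by (rule card_mono[OF finite_fibre_classes])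
    then show ?thesis using card_fibre_classes_recurrent(1)[OF phi_in[OF x(1)] x(2)] by simp
  next
    case True
    then show ?thesis by (metis card.empty zero_le)
  qed
qed

text \<open>The point \<open>z\<close> is periodic and repeats two blocks: one forcing every \<open>\<pi>\<close>-class over \<open>z\<close> to have a
  member with recurrent image, and one keeping the number of \<open>\<psi>\<close>-classes as small as over \<open>\<psi> y1\<close>.\<close>

lemma degree_upper_bound:
  assumes y1: "y1 \<in> Y"
  obtains x where "x \<in> X" "card (class_of X \<pi> ` {u\<in>X. \<pi> u = \<pi> x})
    \<le> card (class_of Y \<psi> ` {y\<in>Y. \<psi> y = \<psi> y1}) * e"
proof -
  obtain K1 :: nat and G1 where G1: "finite G1" "card G1 \<le> card (class_of Y \<psi> ` {y\<in>Y. \<psi> y = \<psi> y1})"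
    "\<And>i s. (i, s) \<in> G1 \<Longrightarrow> 0 \<le> i \<and> i \<le> int K1 \<and> (\<exists>r\<in>{y\<in>Y. \<psi> y = \<psi> y1}. down.st r i = s)"
    "\<And>y. y \<in> {y\<in>Y. near (int K1) (\<psi> y) (\<psi> y1)} \<Longrightarrow> \<exists>(i, s)\<in>G1. down.routes 0 (int K1) i s y"
    by (rule down.transversal_exists[OF down.shrinks_to_fibre[OF down.code, of "\<psi> y1"], of "\<psi> y1"])
      (auto simp only: mem_Collect_eq)
  obtain x0 and Km :: nat where x0: "x0 \<in> X"
    and magic: "\<And>x. x \<in> X \<Longrightarrow> near (int Km) (\<pi> x) (\<pi> x0) \<Longrightarrow> marked.inserts (int Km) x"
    by (rule marked.magic_word) (rule that)
  obtain x1 where x1: "x1 \<in> X" "\<phi> x1 = y1" using y1 phi_onto by blast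
  define K' where "K' = int Km + int K1 + L"
  have K': "0 \<le> K'" "int Km + L \<le> K'" "int K1 + L \<le> K'" using L_nonneg by (auto simp: K'_def)
  obtain x n p where x: "x \<in> X" and np: "2 * K' < p" "p + 2 * K' < n" and per: "\<And>k. translate (k * n) x = x"
    and xx0: "near K' x x0" and xx1: "near K' (translate p x) x1"
    by (rule periodic_point[OF x0 x1(1) K'(1)]) (rule that)
  define z where "z = \<pi> x"
  have n: "0 < n" "int Km + 2 * L < n" using np K' L_nonneg by linarith+
  have zper: "translate (k * n) z = z" for k
    using sliding_code_translate[OF code x, of "k * n"] per by (simp add: z_def)
  have z0: "near (int Km) z (\<pi> x0)"
    unfolding z_def by (rule sliding_code_near[OF code x x0]) (rule near_mono[OF xx0 K'(2)])
  have z1: "near (int K1) (translate p z) (\<psi> y1)"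
  proof -
    have "near (int K1) (\<pi> (translate p x)) (\<pi> x1)"
      by (rule sliding_code_near[OF code translate_in[OF x] x1(1)]) (rule near_mono[OF xx1 K'(3)])
    then show ?thesis
      using sliding_code_translate[OF code x] factor[OF x1(1)] x1(2) by (simp add: z_def)
  qed
  have rep: "\<exists>u'. class_equiv X \<pi> u u' \<and> recurrent (\<phi> u')" if u: "u \<in> X" "\<pi> u = z" for u
  proof -
    have "marked.inserts (int Km) (translate (k * n) u)" for k
      by (rule magic) (use u sliding_code_translate[OF code u(1)] zper z0 in auto)
    then obtain u' where u': "class_equiv X \<pi> u u'" "\<And>m. \<exists>p\<ge>m. near K (\<phi> (translate p u')) y0"
      using marked.recurrently_marked_representative[OF u(1) n(2)] by auto
    have "u' \<in> X" using u'(1) leads_toD(2) unfolding class_equiv_def by blast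
    then have "recurrent (\<phi> u')"
      using u'(2) sliding_code_translate[OF phi_code] by (simp add: recurrent_def hit_def)
    then show ?thesis using u'(1) by blast
  qed
  let ?CY = "class_of Y \<psi> ` {y\<in>Y. \<psi> y = z}"
  have CY: "finite ?CY \<and> card ?CY \<le> card G1"
  proof (rule down.card_classes_le[OF _ _ G1(1), of _ z 0 "int K1"])
    show "0 \<le> i \<and> i \<le> int K1" if "(i, s) \<in> G1" for i s using G1(3)[OF that] by simp
    fix m :: int
    show "\<exists>q\<ge>m. \<forall>y\<in>{y\<in>Y. \<psi> y = z}. \<exists>(i, s)\<in>G1. down.routes (q + 0) (q + int K1) (q + i) s y"
    proof (intro exI[of _ "\<bar>m\<bar> * n + p"] conjI ballI)
      have "\<bar>m\<bar> \<le> \<bar>m\<bar> * n" using n(1) by (simp add: mult_le_cancel_left1)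
      then show "m \<le> \<bar>m\<bar> * n + p" using np K' by linarith
      fix y assume "y \<in> {y\<in>Y. \<psi> y = z}"
      then have y: "y \<in> Y" "\<psi> y = z" by auto
      have "\<psi> (translate (\<bar>m\<bar> * n + p) y) = translate p (translate (\<bar>m\<bar> * n) z)"
        using sliding_code_translate[OF down.code y(1)] y(2) by simp
      also have "\<dots> = translate p z" by (simp only: zper)
      finally have "translate (\<bar>m\<bar> * n + p) y \<in> {y\<in>Y. near (int K1) (\<psi> y) (\<psi> y1)}"
        using z1 y(1) by simp
      then obtain i s where g: "(i, s) \<in> G1" "down.routes 0 (int K1) i s (translate (\<bar>m\<bar> * n + p) y)"
        using G1(4) by blast
      show "\<exists>(i, s)\<in>G1. down.routes (\<bar>m\<bar> * n + p + 0) (\<bar>m\<bar> * n + p + int K1) (\<bar>m\<bar> * n + p + i) s y"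
        using g(1) down.routes_translate[OF g(2) y(1)] by blast
    qed
  qed auto
  let ?C = "class_of X \<pi> ` {u\<in>X. \<pi> u = z}"
  let ?over = "\<lambda>D. {c \<in> ?C. \<exists>u\<in>c. \<phi> u \<in> D}"
  have fC: "finite ?C" by (rule finite_classes[of _ z]) auto
  have "?C \<subseteq> (\<Union>D\<in>?CY. ?over D)"
  proof
    fix c assume c: "c \<in> ?C"
    then obtain u where u: "u \<in> X" "\<pi> u = z" "c = class_of X \<pi> u" by blast
    have "u \<in> c" using u class_equiv_refl by (simp add: class_of_def)
    moreover have "\<phi> u \<in> class_of Y \<psi> (\<phi> u)" using u down.class_equiv_refl by (simp add: class_of_def)
    moreover have "class_of Y \<psi> (\<phi> u) \<in> ?CY" using u factor by auto
    ultimately show "c \<in> (\<Union>D\<in>?CY. ?over D)" using c by blast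
  qed
  then have "card ?C \<le> card (\<Union>D\<in>?CY. ?over D)"
    by (rule card_mono[rotated]) (use CY fC in \<open>intro finite_UN_I; simp\<close>)
  also have "\<dots> \<le> (\<Sum>D\<in>?CY. card (?over D))"
    using CY by (intro card_UN_le) auto
  also have "\<dots> \<le> (\<Sum>D\<in>?CY. e)"
  proof (rule sum_mono)
    fix D assume "D \<in> ?CY"
    then obtain y where y: "y \<in> Y" "D = class_of Y \<psi> y" by blast
    show "card (?over D) \<le> e"
      using few_classes_over_each_class[OF rep y(1)] unfolding y(2) class_of_def[of Y] mem_Collect_eq .
  qed
  also have "\<dots> = card ?CY * e" by simp
  also have "\<dots> \<le> card (class_of Y \<psi> ` {y\<in>Y. \<psi> y = \<psi> y1}) * e"
    using CY G1(2) by (intro mult_right_mono) auto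
  finally show ?thesis using that[OF x] by (simp add: z_def)
qed

end

context code_tower begin

text \<open>Fibres over inequivalent points of \<open>Y\<close> meet disjoint sets of classes, because \<open>\<phi>\<close> maps classes into
  classes.\<close>

lemma degree_lower_bound:
  assumes e: "\<And>y. y \<in> Y \<Longrightarrow> e \<le> card (fibre_classes y)"
  shows "card (class_of Y \<psi> ` {y\<in>Y. \<psi> y = z}) * e \<le> card (class_of X \<pi> ` {x\<in>X. \<pi> x = z})"
proof -
  obtain T where T: "T \<subseteq> {y\<in>Y. \<psi> y = z}" "inj_on (class_of Y \<psi>) T"
    "class_of Y \<psi> ` {y\<in>Y. \<psi> y = z} = class_of Y \<psi> ` T"
    using down.class_representatives[of "class_of Y \<psi> ` {y\<in>Y. \<psi> y = z}" "{y\<in>Y. \<psi> y = z}"] by blast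
  have "finite (class_of Y \<psi> ` {y\<in>Y. \<psi> y = z})" by (rule down.finite_classes[of _ z]) auto
  then have finT: "finite T" "card T = card (class_of Y \<psi> ` {y\<in>Y. \<psi> y = z})"
    using T finite_image_iff card_image by metis+
  have disj: "fibre_classes y \<inter> fibre_classes y' = {}" if yy: "y \<in> T" "y' \<in> T" "y \<noteq> y'" for y y'
  proof (rule ccontr)
    assume "fibre_classes y \<inter> fibre_classes y' \<noteq> {}"
    then obtain x x' where x: "x \<in> X" "\<phi> x = y" "x' \<in> X" "\<phi> x' = y'" "class_of X \<pi> x = class_of X \<pi> x'"
      unfolding fibre_classes_def by blast
    then have "class_equiv Y \<psi> y y'" using class_of_eq_iff phi_class_equiv by blast
    moreover have "y \<in> Y" using yy T(1) by blast
    ultimately have "class_of Y \<psi> y = class_of Y \<psi> y'" using down.class_of_eq_iff by simp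
    then show False using T(2) yy by (meson inj_onD)
  qed
  have "card T * e = (\<Sum>y\<in>T. e)" by simp
  also have "\<dots> \<le> (\<Sum>y\<in>T. card (fibre_classes y))" using e T(1) by (intro sum_mono) auto
  also have "\<dots> = card (\<Union>y\<in>T. fibre_classes y)"
    using finT disj finite_fibre_classes by (intro card_UN_disjoint[symmetric]) auto
  also have "\<dots> \<le> card (class_of X \<pi> ` {x\<in>X. \<pi> x = z})"
  proof (rule card_mono)
    show "finite (class_of X \<pi> ` {x\<in>X. \<pi> x = z})" by (rule finite_classes[of _ z]) auto
    show "(\<Union>y\<in>T. fibre_classes y) \<subseteq> class_of X \<pi> ` {x\<in>X. \<pi> x = z}"
      using T(1) factor unfolding fibre_classes_def by fastforce
  qed
  finally show ?thesis using finT(2) by simp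
qed

lemma class_degree_product:
  assumes "y1 \<in> Y" "y0 \<in> Y"
    and min1: "\<And>y. y \<in> Y \<Longrightarrow> card (class_of Y \<psi> ` {u\<in>Y. \<psi> u = \<psi> y1}) \<le> card (class_of Y \<psi> ` {u\<in>Y. \<psi> u = \<psi> y})"
    and min0: "\<And>y. y \<in> Y \<Longrightarrow> card (fibre_classes y0) \<le> card (fibre_classes y)"
  obtains x where "x \<in> X" "card (class_of X \<pi> ` {u\<in>X. \<pi> u = \<pi> x})
    = card (class_of Y \<psi> ` {u\<in>Y. \<psi> u = \<psi> y1}) * card (fibre_classes y0)"
    "\<And>x'. x' \<in> X \<Longrightarrow> card (class_of X \<pi> ` {u\<in>X. \<pi> u = \<pi> x}) \<le> card (class_of X \<pi> ` {u\<in>X. \<pi> u = \<pi> x'})"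
proof -
  define d where "d = card (class_of Y \<psi> ` {u\<in>Y. \<psi> u = \<psi> y1})"
  define e where "e = card (fibre_classes y0)"
  have lower: "d * e \<le> card (class_of X \<pi> ` {u\<in>X. \<pi> u = \<pi> x})" if "x \<in> X" for x
  proof -
    have "d * e \<le> card (class_of Y \<psi> ` {u\<in>Y. \<psi> u = \<psi> (\<phi> x)}) * e"
      using min1[OF phi_in[OF that]] by (simp add: d_def)
    also have "\<dots> \<le> card (class_of X \<pi> ` {u\<in>X. \<pi> u = \<psi> (\<phi> x)})"
      by (rule degree_lower_bound) (simp add: e_def min0)
    finally show ?thesis using factor[OF that] by simp
  qed
  obtain K :: nat and G where G: "finite G" "card G \<le> card (class_of X \<pi> ` {x\<in>X. \<phi> x = y0})"
    "\<And>i s. (i, s) \<in> G \<Longrightarrow> 0 \<le> i \<and> i \<le> int K \<and> (\<exists>r\<in>{x\<in>X. \<phi> x = y0}. st r i = s)"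
    "\<And>x. x \<in> {x\<in>X. near (int K) (\<phi> x) y0} \<Longrightarrow> \<exists>(i, s)\<in>G. routes 0 (int K) i s x"
    by (rule transversal_exists[OF shrinks_to_fibre[OF phi_code, of y0], of "\<psi> y0"])
      (auto simp: factor)
  interpret minimal_tower X A L \<pi> Y B \<psi> \<phi> e y0 "int K" G
  proof
    show "e \<le> card (fibre_classes y)" if "y \<in> Y" for y using min0[OF that] by (simp add: e_def)
    show "card G \<le> e" using G(2) by (simp add: e_def fibre_classes_def)
    show "0 \<le> i \<and> i \<le> int K" if "(i, s) \<in> G" for i s using G(3)[OF that] by simp
    show "\<exists>(i, s)\<in>G. routes 0 (int K) i s x" if "x \<in> X" "near (int K) (\<phi> x) y0" for x
      using G(4) that by blast
  qed (use assms G in auto)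
  obtain x where x: "x \<in> X" "card (class_of X \<pi> ` {u\<in>X. \<pi> u = \<pi> x}) \<le> d * e"
    unfolding d_def by (rule degree_upper_bound[OF assms(1)])
  then have "card (class_of X \<pi> ` {u\<in>X. \<pi> u = \<pi> x}) = d * e" using lower[OF x(1)] by simp
  then show ?thesis using that[OF x(1)] lower unfolding d_def e_def by simp
qed

end

lemma (in sft_code) class_count_eq: "class_count X \<pi> z = enat (card (class_of X \<pi> ` {x\<in>X. \<pi> x = z}))"
proof -
  have "{class_of X \<pi> x |x. x \<in> X \<and> \<pi> x = z} = class_of X \<pi> ` {x\<in>X. \<pi> x = z}" by blast
  moreover have "finite (class_of X \<pi> ` {x\<in>X. \<pi> x = z})" by (rule finite_classes[of _ z]) auto
  ultimately show ?thesis by (simp add: class_count_def ecard_def)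
qed

lemma (in code_tower) rel_class_count_eq: "rel_class_count X Y \<phi> \<psi> y = enat (card (fibre_classes y))"
proof -
  have "{rel_class_of X Y \<phi> \<psi> x |x. x \<in> X \<and> \<phi> x = y} = fibre_classes y"
    unfolding fibre_classes_def rel_class_of_eq by blast
  then show ?thesis using finite_fibre_classes by (simp add: rel_class_count_def ecard_def)
qed

theorem (in code_tower) class_degree_tower:
  assumes Z: "\<psi> ` Y = Z" and ne: "Y \<noteq> {}"
  shows "class_degree X Z \<pi> = class_degree Y Z \<psi> * rel_class_degree X Y \<phi> \<psi>"
proof -
  obtain y where y: "y \<in> Y" using ne by blast
  obtain y1 where y1: "y1 \<in> Y" "\<And>y. y \<in> Y \<Longrightarrow>
      card (class_of Y \<psi> ` {u\<in>Y. \<psi> u = \<psi> y1}) \<le> card (class_of Y \<psi> ` {u\<in>Y. \<psi> u = \<psi> y})"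
    using ex_has_least_nat[of "\<lambda>y. y \<in> Y" y "\<lambda>y. card (class_of Y \<psi> ` {u\<in>Y. \<psi> u = \<psi> y})"] y by blast
  obtain y0 where y0: "y0 \<in> Y" "\<And>y. y \<in> Y \<Longrightarrow> card (fibre_classes y0) \<le> card (fibre_classes y)"
    using ex_has_least_nat[of "\<lambda>y. y \<in> Y" y "\<lambda>y. card (fibre_classes y)"] y by blast
  obtain x where x: "x \<in> X" "card (class_of X \<pi> ` {u\<in>X. \<pi> u = \<pi> x})
    = card (class_of Y \<psi> ` {u\<in>Y. \<psi> u = \<psi> y1}) * card (fibre_classes y0)"
    "\<And>x'. x' \<in> X \<Longrightarrow> card (class_of X \<pi> ` {u\<in>X. \<pi> u = \<pi> x}) \<le> card (class_of X \<pi> ` {u\<in>X. \<pi> u = \<pi> x'})"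
    by (rule class_degree_product[OF y1(1) y0(1) y1(2) y0(2)]) (assumption, assumption, rule that)
  have Zpi: "\<pi> ` X = Z" using Z phi_onto factor by (force simp: image_iff)
  have "class_degree X Z \<pi> = enat (card (class_of X \<pi> ` {u\<in>X. \<pi> u = \<pi> x}))"
    unfolding class_degree_def class_count_eq
    by (rule INF_enat_eq) (use x Zpi in auto)
  moreover have "class_degree Y Z \<psi> = enat (card (class_of Y \<psi> ` {u\<in>Y. \<psi> u = \<psi> y1}))"
    unfolding class_degree_def down.class_count_eq
    by (rule INF_enat_eq) (use y1 Z in auto)
  moreover have "rel_class_degree X Y \<phi> \<psi> = enat (card (fibre_classes y0))"
    unfolding rel_class_degree_def rel_class_count_eq
    by (rule INF_enat_eq) (use y0 in auto)
  ultimately show ?thesis using x(2) by simp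
qed

lemma sliding_code_if_factor_code:
  assumes X: "sft X A L" and f: "factor_code A X B Y f"
  obtains r where "sliding_code X r f"
proof -
  have B: "finite B" "Y \<subseteq> topspace (full_shift B)"
    using f closedin_subset unfolding factor_code_def shift_space_def by blast+
  have "y i \<in> B" if "y \<in> Y" for y i
  proof -
    have "y \<in> topspace (full_shift B)" using that B(2) by blast
    then show ?thesis by (simp add: full_shift_def PiE_iff)
  qed
  moreover have "continuous_map (subtopology (full_shift A) X) (subtopology (full_shift B) Y) f"
    "\<And>x. x \<in> X \<Longrightarrow> f (shift_map x) = shift_map (f x)" "f ` X \<subseteq> Y"
    using f unfolding factor_code_def by blast+
  ultimately show ?thesis
    using sft.sliding_code_if_continuous[OF X, of B Y f] B(1) that by blast
qed

theorem theorem1p1: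
  fixes A :: "'a set" and B :: "'b set" and C :: "'c set"
    and X :: "(int \<Rightarrow> 'a) set" and Y :: "(int \<Rightarrow> 'b) set" and Z :: "(int \<Rightarrow> 'c) set"
    and \<phi> :: "(int \<Rightarrow> 'a) \<Rightarrow> (int \<Rightarrow> 'b)" and \<psi> :: "(int \<Rightarrow> 'b) \<Rightarrow> (int \<Rightarrow> 'c)"
    and \<pi> :: "(int \<Rightarrow> 'a) \<Rightarrow> (int \<Rightarrow> 'c)"
  assumes "shift_of_finite_type A X" and "irreducible_shift X"
    and "shift_of_finite_type B Y" and "irreducible_shift Y"
    and "sofic_shift C Z"
    and "factor_code A X B Y \<phi>" and "factor_code B Y C Z \<psi>" and "factor_code A X C Z \<pi>"
    and "\<forall>x\<in>X. \<pi> x = \<psi> (\<phi> x)"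
  shows "class_degree X Z \<pi> = class_degree Y Z \<psi> * rel_class_degree X Y \<phi> \<psi>"
proof (cases "Y = {}")
  case True
  then have "Z = {}" using assms(7) by (auto simp: factor_code_def)
  with True show ?thesis by (simp add: class_degree_def rel_class_degree_def top_enat_def)
next
  case False
  have sp: "shift_space A X" "shift_space B Y"
    and onto: "\<phi> ` X = Y" "\<psi> ` Y = Z"
    using assms(6,7) by (simp_all add: factor_code_def)
  obtain LX where LX: "\<And>L. LX \<le> L \<Longrightarrow> sft X A L"
    by (rule sft_if_shift_of_finite_type[OF assms(1) sp(1) assms(2)]) (rule that)
  obtain LY where LY: "\<And>L. LY \<le> L \<Longrightarrow> sft Y B L"
    by (rule sft_if_shift_of_finite_type[OF assms(3) sp(2) assms(4)]) (rule that)
  obtain r1 where r1: "sliding_code X r1 \<phi>"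
    by (rule sliding_code_if_factor_code[OF LX[OF order_refl] assms(6)])
  obtain r2 where r2: "sliding_code Y r2 \<psi>"
    by (rule sliding_code_if_factor_code[OF LY[OF order_refl] assms(7)])
  obtain r3 where r3: "sliding_code X r3 \<pi>"
    by (rule sliding_code_if_factor_code[OF LX[OF order_refl] assms(8)])
  define L where "L = Max {LX, LY, r1, r2, r3}"
  have L: "LX \<le> L" "LY \<le> L" "r1 \<le> L" "r2 \<le> L" "r3 \<le> L"
    by (simp_all add: L_def)
  interpret code_tower X A L \<pi> Y B \<psi> \<phi>
  proof (intro code_tower.intro sft_code.intro LX[OF L(1)] LY[OF L(2)])
    show "sft_code_axioms X L \<pi>"
      by (rule sft_code_axioms.intro) (rule sliding_code_mono[OF r3 L(5)])
    show "sft_code_axioms Y L \<psi>"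
      by (rule sft_code_axioms.intro) (rule sliding_code_mono[OF r2 L(4)])
    show "code_tower_axioms X L \<pi> Y \<psi> \<phi>"
      using sliding_code_mono[OF r1 L(3)] onto(1) assms(9) by (intro code_tower_axioms.intro) simp_all
  qed
  show ?thesis by (rule class_degree_tower[OF onto(2) False])
qed

end
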